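(* Let $2\le k<n$. Assume $\Lambda$ is a subset of the set of all number partitions of $n$ such that $(1^n),(n)\notin\Lambda$ and $\Lambda$ satisfies the following Condition $C_k$: if $\mu\in\Lambda$, $\mu=(\mu_1,\dots,\mu_t)$, where $\mu_i=kq_i+r_i$ with $0\le r_i<k$ for $i\in[t]$, then $\gamma_k(\mu)=(k^{q_1+\dots+q_t},1^{r_1+\dots+r_t})\in\Lambda$. Then for any $\mu\in\Lambda\cup\{(n)\}$ the triangulated space $X_{\Lambda,\mu}=\Delta(\Pi_\Lambda(\hat 0,\pi))/\mathrm{Stab}(\pi)$, where $\pi$ is a set partition of $[n]$ of type $\mu$, is collapsible; in particular, the multiplicity of the trivial representation in the induced $\mathrm{Stab}(\pi)$-representation on $\widetilde H_i(\Delta(\Pi_\Lambda(\hat 0,\pi)),\mathbb{Q})$ is equal to $0$ for all $i$.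
   Context: The type of a set partition is the number partition formed by the sizes of its blocks. $\Pi_n$ is the lattice of all set partitions of $[n]=\{1,\dots,n\}$ ordered by refinement, with minimal element $\hat 0$ the partition into singletons. $\Pi_\Lambda$ is the subposet of $\Pi_n$ consisting of all set partitions whose type belongs to $\Lambda$, and $\Pi_\Lambda(\hat 0,\pi)$ is the set of $\tau\in\Pi_\Lambda$ with $\hat 0<\tau<\pi$ in $\Pi_n$. The symmetric group $\mathcal{S}_n$ acts on $\Pi_n$, and $\mathrm{Stab}(\pi)$ is the stabilizer of $\pi$ in $\mathcal{S}_n$; it acts on $\Pi_\Lambda(\hat 0,\pi)$. $\Delta(P)$ is the order complex of a poset $P$ (simplices are finite chains). The quotient $\Delta(P)/G$ by an order-preserving action of a finite group is a regular CW complex all of whose cells are simplices (a triangulated space), with cells the orbits of simplices of $\Delta(P)$. A finite regular CW complex is collapsible if it can be reduced to a point by a sequence of elementary collapses. The power notation $(k^a,1^b)$ means $a$ parts equal to $k$ and $b$ parts equal to $1$.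
   Formalization: The formal theorem additionally assumes that Π_Λ(0̂,π) is nonempty; without this the claim fails, e.g. for Λ={(k,1^{n-k})} and μ=(k,1^{n-k}), where the complex is empty, hence not collapsible, and H̃_{-1} is the trivial representation. *)

theory Defs
  imports
    "HOL-Library.Multiset"
    "HOL-Library.Disjoint_Sets"
    "HOL-Library.Extended_Nat"
    "HOL-Algebra.Module"
    "HOL-Algebra.Group_Action"
    "HOL-Algebra.Sym_Groups"
begin

section \<open>Number partitions and set partitions\<close>

definition number_partitions :: "nat \<Rightarrow> nat multiset set" where
  "number_partitions n = {\<mu>. 0 \<notin># \<mu> \<and> sum_mset \<mu> = n}"

definition gamma :: "nat \<Rightarrow> nat multiset \<Rightarrow> nat multiset" where
  "gamma k \<mu> = replicate_mset (\<Sum>m\<in>#\<mu>. m div k) k + replicate_mset (\<Sum>m\<in>#\<mu>. m mod k) 1"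

definition condition_C :: "nat \<Rightarrow> nat multiset set \<Rightarrow> bool" where
  "condition_C k \<Lambda> \<longleftrightarrow> (\<forall>\<mu>\<in>\<Lambda>. gamma k \<mu> \<in> \<Lambda>)"

definition partition_type :: "nat set set \<Rightarrow> nat multiset" where
  "partition_type \<pi> = image_mset card (mset_set \<pi>)"

definition bottom_partition :: "nat \<Rightarrow> nat set set" where
  "bottom_partition n = (\<lambda>i. {i}) ` {1..n}"

text \<open>This set can be empty, for instance when \<open>\<Lambda>\<close> contains only the type of \<open>\<pi>\<close>. The order
  complex then has no cells and is not collapsible, and its reduced homology in degree \<open>-1\<close> is the
  trivial representation.\<close>

definition open_interval :: "nat \<Rightarrow> nat multiset set \<Rightarrow> nat set set \<Rightarrow> nat set set set" where
  "open_interval n \<Lambda> \<pi> =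
     {\<tau>. partition_on {1..n} \<tau> \<and> partition_type \<tau> \<in> \<Lambda> \<and>
         refines {1..n} (bottom_partition n) \<tau> \<and> bottom_partition n \<noteq> \<tau> \<and>
         refines {1..n} \<tau> \<pi> \<and> \<tau> \<noteq> \<pi>}"

definition permute_partition :: "(nat \<Rightarrow> nat) \<Rightarrow> nat set set \<Rightarrow> nat set set" where
  "permute_partition g \<pi> = (\<lambda>B. g ` B) ` \<pi>"

definition Stab :: "nat \<Rightarrow> nat set set \<Rightarrow> (nat \<Rightarrow> nat) monoid" where
  "Stab n \<pi> = (sym_group n)\<lparr>carrier := stabilizer (sym_group n) permute_partition \<pi>\<rparr>"


section \<open>Order complexes and their quotients\<close>

text \<open>The empty chain is included; it is the simplex of dimension \<open>-1\<close> that reduced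
  homology needs. It is not a cell of the quotient complex.\<close>

definition order_complex :: "'a set \<Rightarrow> ('a \<Rightarrow> 'a \<Rightarrow> bool) \<Rightarrow> 'a set set" where
  "order_complex P leq = {\<sigma>. finite \<sigma> \<and> \<sigma> \<subseteq> P \<and> (\<forall>x\<in>\<sigma>. \<forall>y\<in>\<sigma>. leq x y \<or> leq y x)}"

definition quotient_cells ::
  "('g, 'm) monoid_scheme \<Rightarrow> ('g \<Rightarrow> 'a \<Rightarrow> 'a) \<Rightarrow> 'a set set \<Rightarrow> 'a set set set" where
  "quotient_cells G act \<Delta> = orbits G (\<Delta> - {{}}) (\<lambda>g \<sigma>. act g ` \<sigma>)"

definition quotient_face :: "'a set set \<Rightarrow> 'a set set \<Rightarrow> bool" where
  "quotient_face s t \<longleftrightarrow> (\<exists>\<sigma>\<in>s. \<exists>\<tau>\<in>t. \<sigma> \<subseteq> \<tau>)"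

text \<open>A finite regular CW complex is given by its set of (nonempty) cells and the relation
  \<open>face s t\<close>: the cell \<open>s\<close> lies in the closure of the cell \<open>t\<close>. An elementary collapse removes
  a free face \<open>s\<close> together with the only other cell \<open>t\<close> whose closure contains it. Uniqueness of
  \<open>t\<close> forces \<open>t\<close> to be maximal and \<open>s\<close> to have codimension one in \<open>t\<close>, since the face poset is
  graded. A subcomplex with exactly one cell is a point.\<close>

definition elementary_collapse :: "('c \<Rightarrow> 'c \<Rightarrow> bool) \<Rightarrow> 'c set \<Rightarrow> 'c set \<Rightarrow> bool" where
  "elementary_collapse face C D \<longleftrightarrow>
     (\<exists>s\<in>C. \<exists>t\<in>C. s \<noteq> t \<and> face s t \<and> (\<forall>u\<in>C. face s u \<longrightarrow> u = s \<or> u = t) \<and> D = C - {s, t})"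

definition collapsible :: "'c set \<Rightarrow> ('c \<Rightarrow> 'c \<Rightarrow> bool) \<Rightarrow> bool" where
  "collapsible C face \<longleftrightarrow> (\<exists>v\<in>C. (elementary_collapse face)\<^sup>*\<^sup>* C {v})"


definition interval_complex :: "nat \<Rightarrow> nat multiset set \<Rightarrow> nat set set \<Rightarrow> nat set set set set" where
  "interval_complex n \<Lambda> \<pi> = order_complex (open_interval n \<Lambda> \<pi>) (refines {1..n})"


section \<open>Reduced rational homology of an order complex\<close>

text \<open>A rational \<open>i\<close>-chain is a function on simplices supported on those with \<open>i + 1\<close> elements.
  Every simplex is oriented by the order of the poset. An order-preserving group action respects
  these orientations, so it acts on chains without signs.\<close>

definition chain_space :: "'a set set \<Rightarrow> int \<Rightarrow> ('a set \<Rightarrow> rat) set" where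
  "chain_space \<Delta> i = {f. \<forall>\<sigma>. f \<sigma> \<noteq> 0 \<longrightarrow> \<sigma> \<in> \<Delta> \<and> int (card \<sigma>) = i + 1}"

text \<open>Here \<open>card {y \<in> \<tau>. leq y x \<and> y \<noteq> x}\<close> is the index, counted from \<open>0\<close>, of the vertex \<open>x\<close> in
  the chain \<open>\<tau>\<close>.\<close>

definition boundary ::
  "'a set set \<Rightarrow> ('a \<Rightarrow> 'a \<Rightarrow> bool) \<Rightarrow> ('a set \<Rightarrow> rat) \<Rightarrow> 'a set \<Rightarrow> rat" where
  "boundary \<Delta> leq f =
     (\<lambda>\<sigma>. \<Sum>\<tau>\<in>\<Delta>. f \<tau> * (\<Sum>x\<in>\<tau>. if \<tau> - {x} = \<sigma> then (-1) ^ card {y \<in> \<tau>. leq y x \<and> y \<noteq> x} else 0))"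

definition cycle_space ::
  "'a set set \<Rightarrow> ('a \<Rightarrow> 'a \<Rightarrow> bool) \<Rightarrow> int \<Rightarrow> ('a set \<Rightarrow> rat) set" where
  "cycle_space \<Delta> leq i = {f \<in> chain_space \<Delta> i. boundary \<Delta> leq f = (\<lambda>_. 0)}"

definition boundary_space ::
  "'a set set \<Rightarrow> ('a \<Rightarrow> 'a \<Rightarrow> bool) \<Rightarrow> int \<Rightarrow> ('a set \<Rightarrow> rat) set" where
  "boundary_space \<Delta> leq i = boundary \<Delta> leq ` chain_space \<Delta> (i + 1)"

definition homologous ::
  "'a set set \<Rightarrow> ('a \<Rightarrow> 'a \<Rightarrow> bool) \<Rightarrow> int \<Rightarrow> (('a set \<Rightarrow> rat) \<times> ('a set \<Rightarrow> rat)) set" where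
  "homologous \<Delta> leq i =
     {(f, g). f \<in> cycle_space \<Delta> leq i \<and> g \<in> cycle_space \<Delta> leq i \<and>
              (\<lambda>\<sigma>. f \<sigma> - g \<sigma>) \<in> boundary_space \<Delta> leq i}"

text \<open>The elements of the homology space are the classes of cycles modulo boundaries. The fields
  \<open>mult\<close> and \<open>one\<close>, which the record type inherits from rings, play no role.\<close>

definition reduced_homology ::
  "'a set set \<Rightarrow> ('a \<Rightarrow> 'a \<Rightarrow> bool) \<Rightarrow> int \<Rightarrow> (rat, ('a set \<Rightarrow> rat) set) module" where
  "reduced_homology \<Delta> leq i =
     \<lparr>carrier = cycle_space \<Delta> leq i // homologous \<Delta> leq i,
      monoid.mult = undefined,
      one = undefined,
      zero = homologous \<Delta> leq i `` {\<lambda>_. 0},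
      add = (\<lambda>K L. homologous \<Delta> leq i `` {(\<lambda>\<sigma>. f \<sigma> + g \<sigma>) | f g. f \<in> K \<and> g \<in> L}),
      smult = (\<lambda>c K. homologous \<Delta> leq i `` {(\<lambda>\<sigma>. c * f \<sigma>) | f. f \<in> K})\<rparr>"

definition chain_map ::
  "'a set set \<Rightarrow> ('a \<Rightarrow> 'a) \<Rightarrow> ('a set \<Rightarrow> rat) \<Rightarrow> 'a set \<Rightarrow> rat" where
  "chain_map \<Delta> h f = (\<lambda>\<sigma>. \<Sum>\<tau> | \<tau> \<in> \<Delta> \<and> h ` \<tau> = \<sigma>. f \<tau>)"

definition homology_map ::
  "'a set set \<Rightarrow> ('a \<Rightarrow> 'a \<Rightarrow> bool) \<Rightarrow> int \<Rightarrow> ('a \<Rightarrow> 'a) \<Rightarrow>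
   ('a set \<Rightarrow> rat) set \<Rightarrow> ('a set \<Rightarrow> rat) set" where
  "homology_map \<Delta> leq i h K = homologous \<Delta> leq i `` (chain_map \<Delta> h ` K)"


section \<open>Multiplicity of the trivial representation\<close>

definition rat_field :: "rat ring" where
  "rat_field = \<lparr>carrier = UNIV, monoid.mult = (*), one = 1, zero = 0, add = (+)\<rparr>"

text \<open>The multiplicity of the trivial representation in a representation \<open>V\<close> of \<open>G\<close> is the
  largest \<open>m\<close> such that \<open>V\<close> is the direct sum of \<open>m\<close> copies of the trivial representation, spanned
  by the invariant vectors \<open>v 0, \<dots>, v (m - 1)\<close>, and a subrepresentation \<open>W\<close>. The last conjunct says
  that every vector has a unique expression as a linear combination of the \<open>v j\<close> plus an element
  of \<open>W\<close>.\<close>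

definition trivial_multiplicity ::
  "('g, 'm) monoid_scheme \<Rightarrow> ('g \<Rightarrow> 'v \<Rightarrow> 'v) \<Rightarrow> (rat, 'v) module \<Rightarrow> enat" where
  "trivial_multiplicity G \<rho> V =
     Sup {enat m | m v W.
       (\<forall>j<m. v j \<in> carrier V \<and> (\<forall>g\<in>carrier G. \<rho> g (v j) = v j)) \<and>
       submodule W rat_field V \<and> (\<forall>g\<in>carrier G. \<rho> g ` W \<subseteq> W) \<and>
       bij_betw (\<lambda>(c, w). (\<Oplus>\<^bsub>V\<^esub>j\<in>{..<m}. c j \<odot>\<^bsub>V\<^esub> v j) \<oplus>\<^bsub>V\<^esub> w)
         (({..<m} \<rightarrow>\<^sub>E (UNIV :: rat set)) \<times> W) (carrier V)}"

end

theory Submission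
  imports Defs
begin

text \<open>Call a set partition of \<open>k\<close>-type if all its blocks have size \<open>1\<close> or \<open>k\<close>. Below an element
  \<open>x\<close> consider the elements of \<open>k\<close>-type with the maximal number of \<open>k\<close>-blocks, the full ones. Given a
  chain, let the pivot be its least element that is not of \<open>k\<close>-type (or \<open>\<pi>\<close> if there is none), and
  toggle an element \<open>y\<close> that is full below the pivot and above everything in the chain below the
  pivot. Such \<open>y\<close> exists because sets of disjoint \<open>k\<close>-subsets can be extended greedily, and it is
  unique up to the stabilizer of the chain, so toggling is a perfect matching on the orbits of chains,
  the empty chain included. The partner of the empty chain is a vertex. Ordering the pairs
  lexicographically, first by the number of elements weakly above the pivot and then by the number of
  elements other than \<open>y\<close>, the matched pairs can be collapsed from the largest to the smallest, which
  leaves this vertex.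

  Each collapse removes a free orbit \<open>s\<close> and its only coface \<open>t\<close>. All incidences of \<open>s\<close> with \<open>t\<close> carry
  the same sign, so an invariant cycle vanishes on \<open>t\<close> and can be changed by an invariant boundary
  so as to vanish on \<open>s\<close> as well. Hence invariant cycles are boundaries, and by averaging over the
  group so is every cycle with invariant homology class.\<close>

section \<open>Collapsing quotients of order complexes\<close>

text \<open>The obstacle is that a chain may have many full extensions, so toggling becomes a
  matching only on orbits. For a pivot \<open>x\<close> of the interval, condition
  \<open>C\<^sub>k\<close> puts \<open>gamma k\<close> of its type into \<open>\<Lambda>\<close>. A
  full element below \<open>x\<close> therefore has exactly \<open>card B div k\<close> k-blocks in
  every block \<open>B\<close> of \<open>x\<close>. Two such elements differ by a permutation that
  preserves each block of \<open>x\<close>, and this fixes everything above \<open>x\<close>. If the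
  pivot is \<open>\<pi>\<close> and has type (n) or k-type, the condition gives no such count. In
  the first case there is only one block, and the number of k-blocks is the only datum. In the
  second the blocks of \<open>\<pi>\<close> themselves are permuted, which does no harm because
  nothing in the interval lies above \<open>\<pi>\<close>. Below the pivot the k-blocks of the chain
  have to stay in place; they are k-blocks of both full elements. Throughout, a k-type partition is
  determined by its set of k-blocks, and its type by their number.\<close>

lemma collapsible_matching:
  fixes key :: "'c \<Rightarrow> nat"
  assumes "finite S" "inj_on m S" "S \<inter> m ` S = {}" "v \<notin> S \<union> m ` S"
    and face_m: "\<And>s. s \<in> S \<Longrightarrow> face s (m s)"
    and face_v: "\<And>s. s \<in> S \<Longrightarrow> \<not> face s v"
    and key: "\<And>s s'. s \<in> S \<Longrightarrow> s' \<in> S \<Longrightarrow> face s s' \<or> face s (m s') \<Longrightarrow> s' = s \<or> key s < key s'"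
  shows "collapsible (insert v (S \<union> m ` S)) face"
proof -
  \<comment> \<open>\<open>finite_ranking_induct\<close> adds a pair whose \<open>key\<close> is
    maximal among those present. The lower cell of this pair then lies in no other pair, so the
    induction runs through the collapses in reverse.\<close>
  have "S' \<subseteq> S \<longrightarrow> (elementary_collapse face)\<^sup>*\<^sup>* (insert v (S' \<union> m ` S')) {v}" if "finite S'" for S'
    using that
  proof (induction S' rule: finite_ranking_induct[where f = key])
    case empty
    then show ?case by simp
  next
    case (insert s S')
    show ?case
    proof (intro impI)
      assume sub: "insert s S' \<subseteq> S"
      show "(elementary_collapse face)\<^sup>*\<^sup>* (insert v (insert s S' \<union> m ` insert s S')) {v}"
      proof (cases "s \<in> S'")
        case True
        then show ?thesis using insert.IH sub by (simp add: insert_absorb)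
      next
        case False
        have ms: "m s \<notin> m ` S'"
          using False sub \<open>inj_on m S\<close> by (metis image_iff inj_onD insert_subset subsetD)
        have "m s \<notin> S" "s \<notin> m ` S" "v \<noteq> s" "v \<noteq> m s" using assms sub by auto
        then have D: "insert v (S' \<union> m ` S') = insert v (insert s S' \<union> m ` insert s S') - {s, m s}"
          using False ms sub by auto
        have "u = s \<or> u = m s" if u: "u \<in> insert v (insert s S' \<union> m ` insert s S')" "face s u" for u
        proof -
          have "u \<noteq> v" using face_v that sub by auto
          then obtain s' where s': "s' \<in> insert s S'" "u = s' \<or> u = m s'" using u(1) by auto
          have "key s' \<le> key s" using insert.hyps s' by auto
          then have "s' = s" using key[of s s'] s' sub that(2) by auto
          then show ?thesis using s' by simp
        qed
        then have "elementary_collapse face (insert v (insert s S' \<union> m ` insert s S')) (insert v (S' \<union> m ` S'))"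
          unfolding elementary_collapse_def D
          using sub face_m \<open>m s \<notin> S\<close> by (intro bexI[of _ s] bexI[of _ "m s"]) auto
        then show ?thesis using insert.IH sub by (simp add: converse_rtranclp_into_rtranclp)
      qed
    qed
  qed
  from this[OF \<open>finite S\<close>] show ?thesis unfolding collapsible_def by blast
qed

text \<open>The rank is constant on orbits and strictly increasing, so distinct vertices of one
  simplex lie in different orbits. It also yields antisymmetry on \<open>P\<close> and makes the
  position of a vertex in a chain a matter of ranks alone.\<close>

locale ranked_poset_action = group G
  for G :: "('g, 'm) monoid_scheme" (structure) and act :: "'g \<Rightarrow> 'a \<Rightarrow> 'a"
    and P :: "'a set" and leq :: "'a \<Rightarrow> 'a \<Rightarrow> bool" and rk :: "'a \<Rightarrow> nat" +
  assumes finite_carrier: "finite (carrier G)"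
    and act_one: "act \<one> x = x"
    and act_mult: "g \<in> carrier G \<Longrightarrow> h \<in> carrier G \<Longrightarrow> act (g \<otimes> h) x = act g (act h x)"
    and finite_P: "finite P"
    and act_P: "g \<in> carrier G \<Longrightarrow> x \<in> P \<Longrightarrow> act g x \<in> P"
    and leq_refl: "x \<in> P \<Longrightarrow> leq x x"
    and act_leq: "g \<in> carrier G \<Longrightarrow> x \<in> P \<Longrightarrow> y \<in> P \<Longrightarrow> leq x y \<Longrightarrow> leq (act g x) (act g y)"
    and rk_act: "g \<in> carrier G \<Longrightarrow> x \<in> P \<Longrightarrow> rk (act g x) = rk x"
    and rk_mono: "x \<in> P \<Longrightarrow> y \<in> P \<Longrightarrow> leq x y \<Longrightarrow> x \<noteq> y \<Longrightarrow> rk x < rk y"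
begin

section \<open>Orbits of simplices and the face relation of the quotient\<close>

abbreviation \<Delta> :: "'a set set" where "\<Delta> \<equiv> order_complex P leq"

definition orb :: "'a set \<Rightarrow> 'a set set" where "orb \<sigma> = {act g ` \<sigma> | g. g \<in> carrier G}"

abbreviation cells :: "'a set set set" where "cells \<equiv> quotient_cells G act \<Delta>"

lemma act_inv_act:
  assumes "g \<in> carrier G"
  shows "act (inv g) (act g x) = x" "act g (act (inv g) x) = x"
  using assms by (simp_all flip: act_mult add: act_one)

lemma act_inj: "g \<in> carrier G \<Longrightarrow> inj (act g)"
  by (metis act_inv_act(1) injI)

lemma act_P_iff: "g \<in> carrier G \<Longrightarrow> act g x \<in> P \<longleftrightarrow> x \<in> P"
  by (metis act_P act_inv_act(1) inv_closed)

lemma act_leq_iff: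
  "g \<in> carrier G \<Longrightarrow> x \<in> P \<Longrightarrow> y \<in> P \<Longrightarrow> leq (act g x) (act g y) \<longleftrightarrow> leq x y"
  by (metis act_P act_inv_act(1) act_leq inv_closed)

lemma image_act_inv:
  assumes "g \<in> carrier G"
  shows "act (inv g) ` act g ` \<sigma> = \<sigma>" "act g ` act (inv g) ` \<sigma> = \<sigma>"
  using assms by (simp_all add: image_image act_inv_act)

lemma card_image_act: "g \<in> carrier G \<Longrightarrow> card (act g ` \<sigma>) = card \<sigma>"
  by (meson act_inj card_image inj_on_subset subset_UNIV)

lemma finite_\<Delta>: "finite \<Delta>"
  by (rule finite_subset[of _ "Pow P"]) (auto simp: order_complex_def finite_P)

lemma \<Delta>D:
  assumes "\<sigma> \<in> \<Delta>"
  shows "finite \<sigma>" "\<sigma> \<subseteq> P" "\<And>x y. x \<in> \<sigma> \<Longrightarrow> y \<in> \<sigma> \<Longrightarrow> leq x y \<or> leq y x"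
  using assms by (auto simp: order_complex_def)

lemma \<Delta>_subset: "\<sigma> \<in> \<Delta> \<Longrightarrow> \<rho> \<subseteq> \<sigma> \<Longrightarrow> \<rho> \<in> \<Delta>"
  unfolding order_complex_def by (auto intro: finite_subset)

lemma empty_in_\<Delta>: "{} \<in> \<Delta>"
  by (simp add: order_complex_def)

lemma singleton_in_\<Delta>: "x \<in> P \<Longrightarrow> {x} \<in> \<Delta>"
  by (simp add: order_complex_def leq_refl)

lemma act_\<Delta>: "g \<in> carrier G \<Longrightarrow> \<sigma> \<in> \<Delta> \<Longrightarrow> act g ` \<sigma> \<in> \<Delta>"
  unfolding order_complex_def by (auto simp: act_P subset_iff act_leq_iff)

lemma act_\<Delta>_iff: "g \<in> carrier G \<Longrightarrow> act g ` \<sigma> \<in> \<Delta> \<longleftrightarrow> \<sigma> \<in> \<Delta>"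
  by (metis act_\<Delta> image_act_inv(1) inv_closed)

lemma chain_leq_iff_rk:
  assumes "\<sigma> \<in> \<Delta>" "x \<in> \<sigma>" "y \<in> \<sigma>"
  shows "leq x y \<and> x \<noteq> y \<longleftrightarrow> rk x < rk y"
  using assms \<Delta>D[OF assms(1)] rk_mono by (metis less_asym order_less_irrefl subsetD)

lemma orb_eqI:
  assumes "g \<in> carrier G" shows "orb (act g ` \<sigma>) = orb \<sigma>"
proof -
  have "act h ` act g ` \<sigma> \<in> orb \<sigma>" if "h \<in> carrier G" for h
    using that assms unfolding orb_def
    by (auto intro!: exI[of _ "h \<otimes> g"] simp: act_mult image_image)
  moreover have "act h ` \<sigma> \<in> orb (act g ` \<sigma>)" if "h \<in> carrier G" for h
    using that assms unfolding orb_def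
    by (auto intro!: exI[of _ "h \<otimes> inv g"] simp: act_mult image_image act_inv_act)
  ultimately show ?thesis unfolding orb_def by blast
qed

lemma orb_self: "\<sigma> \<in> orb \<sigma>"
  unfolding orb_def using act_one by (auto intro!: exI[of _ \<one>])

lemma orb_eq_iff: "orb \<sigma> = orb \<tau> \<longleftrightarrow> (\<exists>g\<in>carrier G. \<tau> = act g ` \<sigma>)"
proof
  assume "orb \<sigma> = orb \<tau>"
  then have "\<tau> \<in> orb \<sigma>" using orb_self by simp
  then show "\<exists>g\<in>carrier G. \<tau> = act g ` \<sigma>" unfolding orb_def by blast
qed (auto simp: orb_eqI)

lemma mem_orb_iff: "\<tau> \<in> orb \<sigma> \<longleftrightarrow> orb \<tau> = orb \<sigma>"
proof -
  have "\<tau> \<in> orb \<sigma> \<longleftrightarrow> (\<exists>g\<in>carrier G. \<tau> = act g ` \<sigma>)" unfolding orb_def by blast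
  then show ?thesis using orb_eq_iff[of \<sigma> \<tau>] by metis
qed

lemma cells_eq: "cells = orb ` (\<Delta> - {{}})"
  unfolding quotient_cells_def orbits_def orbit_def orb_def by blast

lemma mem_cellD:
  assumes "s \<in> cells" "\<sigma> \<in> s"
  shows "orb \<sigma> = s" "\<sigma> \<in> \<Delta>" "\<sigma> \<noteq> {}"
proof -
  obtain \<rho> where \<rho>: "s = orb \<rho>" "\<rho> \<in> \<Delta>" "\<rho> \<noteq> {}" using assms(1) cells_eq by auto
  then show "orb \<sigma> = s" using assms mem_orb_iff by simp
  show "\<sigma> \<in> \<Delta>" "\<sigma> \<noteq> {}" using \<rho> assms(2) by (auto simp: orb_def act_\<Delta>)
qed

text \<open>Translation by an inverse allows the representative of the lower cell to be fixed in
  advance. Faces of the quotient thus become honest inclusions of chains.\<close>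

lemma face_orb_iff: "quotient_face (orb \<sigma>) (orb \<tau>) \<longleftrightarrow> (\<exists>\<rho>\<in>orb \<tau>. \<sigma> \<subseteq> \<rho>)"
proof
  assume "quotient_face (orb \<sigma>) (orb \<tau>)"
  then obtain g h where gh: "g \<in> carrier G" "h \<in> carrier G" "act g ` \<sigma> \<subseteq> act h ` \<tau>"
    unfolding quotient_face_def orb_def by blast
  then have "\<sigma> \<subseteq> act (inv g) ` act h ` \<tau>"
    by (metis image_act_inv(1) image_mono)
  moreover have "act (inv g) ` act h ` \<tau> \<in> orb \<tau>"
    using gh by (simp add: mem_orb_iff orb_eqI)
  ultimately show "\<exists>\<rho>\<in>orb \<tau>. \<sigma> \<subseteq> \<rho>" by blast
qed (use orb_self in \<open>auto simp: quotient_face_def\<close>)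

lemma face_orb_cellD:
  assumes "t \<in> cells" "quotient_face (orb \<sigma>) t"
  obtains \<tau> where "\<tau> \<in> \<Delta>" "t = orb \<tau>" "\<sigma> \<subseteq> \<tau>"
proof -
  obtain \<tau>0 where \<tau>0: "t = orb \<tau>0" using assms(1) cells_eq by auto
  then obtain \<tau> where "\<tau> \<in> orb \<tau>0" "\<sigma> \<subseteq> \<tau>" using assms(2) face_orb_iff by auto
  then show ?thesis using that assms(1) \<tau>0 mem_cellD by metis
qed

text \<open>Transfers a matching of chains to orbits. \<open>T\<close> holds the upper members of
  the pairs and \<open>rem\<close> passes to the lower ones. Since \<open>rem\<close> has to be
  injective only up to orbits, there need not be a matching on the chains themselves.\<close>

lemma collapsible_quotient:
  fixes T :: "'a set set" and rem :: "'a set \<Rightarrow> 'a set" and key :: "'a set \<Rightarrow> nat"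
  assumes T_sub: "T \<subseteq> \<Delta>"
    and T_act: "\<And>g \<tau>. g \<in> carrier G \<Longrightarrow> \<tau> \<in> T \<Longrightarrow> act g ` \<tau> \<in> T"
    and rem_act: "\<And>g \<tau>. g \<in> carrier G \<Longrightarrow> \<tau> \<in> T \<Longrightarrow> rem (act g ` \<tau>) = act g ` rem \<tau>"
    and key_act: "\<And>g \<sigma>. g \<in> carrier G \<Longrightarrow> \<sigma> \<in> \<Delta> \<Longrightarrow> key (act g ` \<sigma>) = key \<sigma>"
    and rem_notin: "\<And>\<tau>. \<tau> \<in> T \<Longrightarrow> rem \<tau> \<notin> T"
    and rem_subset: "\<And>\<tau>. \<tau> \<in> T \<Longrightarrow> rem \<tau> \<subset> \<tau>"
    and key_rem: "\<And>\<tau>. \<tau> \<in> T \<Longrightarrow> key (rem \<tau>) = key \<tau>"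
    and rem_surj: "\<And>\<sigma>. \<sigma> \<in> \<Delta> - T \<Longrightarrow> \<exists>\<tau>\<in>T. rem \<tau> = \<sigma>"
    and rem_inj: "\<And>\<tau> \<tau>'. \<tau> \<in> T \<Longrightarrow> \<tau>' \<in> T \<Longrightarrow> rem \<tau> = rem \<tau>' \<Longrightarrow> orb \<tau> = orb \<tau>'"
    and key_less: "\<And>\<sigma> \<rho>. \<sigma> \<in> \<Delta> - T \<Longrightarrow> \<rho> \<in> \<Delta> \<Longrightarrow> \<sigma> \<subseteq> \<rho> \<Longrightarrow>
           \<rho> = \<sigma> \<or> \<rho> \<in> T \<and> rem \<rho> = \<sigma> \<or> key \<sigma> < key \<rho>"
    and rem_empty: "\<And>\<tau>. \<tau> \<in> T \<Longrightarrow> rem \<tau> = {} \<Longrightarrow> card \<tau> = 1"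
  shows "collapsible cells quotient_face"
proof -
  have T_orb: "\<sigma> \<in> T" if "orb \<sigma> = orb \<tau>" "\<tau> \<in> T" for \<sigma> \<tau>
    using that T_act orb_eq_iff by metis
  have empty_T: "{} \<notin> T" using rem_subset by blast
  have rem_\<Delta>: "rem \<tau> \<in> \<Delta> - T" if "\<tau> \<in> T" for \<tau>
    using that rem_notin rem_subset T_sub \<Delta>_subset by blast
  have inj_orb: "orb \<tau> = orb \<tau>'" if "\<tau> \<in> T" "\<tau>' \<in> T" and eq: "orb (rem \<tau>) = orb (rem \<tau>')" for \<tau> \<tau>'
  proof -
    obtain g where "g \<in> carrier G" "rem \<tau>' = act g ` rem \<tau>" using eq orb_eq_iff by auto
    then show ?thesis using rem_inj[of "act g ` \<tau>" \<tau>'] that rem_act T_act by (simp add: orb_eqI)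
  qed
  have orb_rem: "orb (rem \<tau>) = orb (rem \<tau>')" if "\<tau> \<in> T" "\<tau>' \<in> T" "orb \<tau> = orb \<tau>'" for \<tau> \<tau>'
    using that orb_eq_iff rem_act orb_eqI by metis
  \<comment> \<open>The empty chain is not a cell. Its partner, a vertex by
    \<open>rem_empty\<close>, loses its mate and is the point that survives the collapses.\<close>
  obtain \<tau>0 where \<tau>0: "\<tau>0 \<in> T" "rem \<tau>0 = {}" using rem_surj empty_in_\<Delta> empty_T by blast
  have orb_empty: "orb \<sigma> = orb {} \<longleftrightarrow> \<sigma> = {}" for \<sigma> using orb_eq_iff[of "{}" \<sigma>] group.is_group by auto
  \<comment> \<open>An inverse of \<open>rem\<close> on orbits; by \<open>inj_orb\<close> the choice
    does not affect the value.\<close>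
  define m where "m s = (SOME u. \<exists>\<tau>\<in>T. u = orb \<tau> \<and> orb (rem \<tau>) = s)" for s
  have m_rem: "m (orb (rem \<tau>)) = orb \<tau>" if "\<tau> \<in> T" for \<tau>
  proof -
    have "\<exists>\<tau>'\<in>T. m (orb (rem \<tau>)) = orb \<tau>' \<and> orb (rem \<tau>') = orb (rem \<tau>)"
      unfolding m_def by (rule someI_ex) (use that in blast)
    then show ?thesis using inj_orb that by metis
  qed
  define okey where "okey s = key (SOME \<sigma>. \<sigma> \<in> s)" for s
  have okey: "okey (orb \<sigma>) = key \<sigma>" if "\<sigma> \<in> \<Delta>" for \<sigma>
  proof -
    have "(SOME \<rho>. \<rho> \<in> orb \<sigma>) \<in> orb \<sigma>" by (rule someI) (rule orb_self)
    then show ?thesis unfolding okey_def using key_act that by (auto simp: orb_def)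
  qed
  define S where "S = orb ` (\<Delta> - T - {{}})"
  have S_T: "\<exists>\<tau>\<in>T. s = orb (rem \<tau>) \<and> rem \<tau> \<noteq> {}" if "s \<in> S" for s
    using that rem_surj unfolding S_def by blast
  have rem_S: "orb (rem \<tau>) \<in> S" if "\<tau> \<in> T" "rem \<tau> \<noteq> {}" for \<tau>
    using that rem_\<Delta> unfolding S_def by blast
  have mS: "m ` S = orb ` {\<tau> \<in> T. rem \<tau> \<noteq> {}}"
  proof (intro equalityI subsetI)
    fix u assume "u \<in> m ` S"
    then obtain s where s: "s \<in> S" "u = m s" by blast
    obtain \<tau> where \<tau>: "\<tau> \<in> T" "s = orb (rem \<tau>)" "rem \<tau> \<noteq> {}" using S_T[OF s(1)] by blast
    then show "u \<in> orb ` {\<tau> \<in> T. rem \<tau> \<noteq> {}}" using s(2) m_rem by simp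
  next
    fix u assume "u \<in> orb ` {\<tau> \<in> T. rem \<tau> \<noteq> {}}"
    then obtain \<tau> where "u = orb \<tau>" "\<tau> \<in> T" "rem \<tau> \<noteq> {}" by blast
    then show "u \<in> m ` S" using m_rem[of \<tau>] rem_S[of \<tau>] by (simp add: rev_image_eqI)
  qed
  have notin_S: "orb \<tau> \<notin> S" if "\<tau> \<in> T" for \<tau>
  proof
    assume "orb \<tau> \<in> S"
    then obtain \<sigma> where "orb \<sigma> = orb \<tau>" "\<sigma> \<notin> T" unfolding S_def by force
    then show False using T_orb[OF _ that] by blast
  qed
  have \<tau>0_unique: "orb \<tau> = orb \<tau>0 \<longleftrightarrow> rem \<tau> = {}" if "\<tau> \<in> T" for \<tau>
    using that \<tau>0 inj_orb orb_rem orb_empty by metis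
  have cells: "cells = insert (orb \<tau>0) (S \<union> m ` S)"
  proof -
    have "\<Delta> - {{}} = (\<Delta> - T - {{}}) \<union> {\<tau> \<in> T. rem \<tau> \<noteq> {}} \<union> {\<tau> \<in> T. rem \<tau> = {}}"
      using T_sub empty_T by auto
    moreover have "orb ` {\<tau> \<in> T. rem \<tau> = {}} = {orb \<tau>0}" using \<tau>0 \<tau>0_unique by auto
    ultimately have "cells = S \<union> orb ` {\<tau> \<in> T. rem \<tau> \<noteq> {}} \<union> {orb \<tau>0}"
      unfolding cells_eq S_def by (simp only: image_Un)
    then show ?thesis unfolding mS by blast
  qed
  show ?thesis unfolding cells
  proof (rule collapsible_matching[where key = okey])
    show "finite S" unfolding S_def using finite_\<Delta> by simp
    show "inj_on m S"
    proof (rule inj_onI)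
      fix s s' assume s: "s \<in> S" "s' \<in> S" "m s = m s'"
      from S_T[OF s(1)] S_T[OF s(2)] obtain \<tau> \<tau>' where
        "\<tau> \<in> T" "s = orb (rem \<tau>)" "\<tau>' \<in> T" "s' = orb (rem \<tau>')" by blast
      then show "s = s'" using s(3) m_rem orb_rem by metis
    qed
    show "S \<inter> m ` S = {}" unfolding mS using notin_S by blast
    show "orb \<tau>0 \<notin> S \<union> m ` S" 
    proof -
      have "orb \<tau>0 \<noteq> orb \<tau>" if "\<tau> \<in> T" "rem \<tau> \<noteq> {}" for \<tau>
        using \<tau>0_unique[OF that(1)] that(2) by metis
      then show ?thesis unfolding mS using notin_S[OF \<tau>0(1)] by blast
    qed
    show "quotient_face s (m s)" if "s \<in> S" for s
      using S_T[OF that] m_rem rem_subset orb_self unfolding quotient_face_def by blast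
    \<comment> \<open>The chains in \<open>orb \<tau>0\<close> have one element and belong to
      \<open>T\<close>. A nonempty subset of such a chain is the whole chain, so it cannot lie
      outside \<open>T\<close>.\<close>
    show "\<not> quotient_face s (orb \<tau>0)" if s: "s \<in> S" for s
    proof
      obtain \<sigma> where \<sigma>: "s = orb \<sigma>" "\<sigma> \<in> \<Delta>" "\<sigma> \<notin> T" "\<sigma> \<noteq> {}" using s unfolding S_def by auto
      assume "quotient_face s (orb \<tau>0)"
      then obtain \<rho> where \<rho>: "\<rho> \<in> orb \<tau>0" "\<sigma> \<subseteq> \<rho>" unfolding \<sigma> face_orb_iff by auto
      then have "\<rho> \<in> T" using T_orb \<tau>0 mem_orb_iff by blast
      moreover have "card \<rho> = 1" using \<rho> rem_empty[OF \<tau>0] by (auto simp: orb_def card_image_act)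
      ultimately show False using \<rho> \<sigma> by (metis card_1_singletonE subset_singletonD)
    qed
    show "s' = s \<or> okey s < okey s'"
      if s: "s \<in> S" "s' \<in> S" and face: "quotient_face s s' \<or> quotient_face s (m s')" for s s'
    proof -
      obtain \<sigma> where \<sigma>: "s = orb \<sigma>" "\<sigma> \<in> \<Delta> - T" "\<sigma> \<noteq> {}" using s(1) unfolding S_def by auto
      from face show ?thesis
      proof
        assume "quotient_face s s'"
        then obtain \<rho> where \<rho>: "\<rho> \<in> \<Delta>" "s' = orb \<rho>" "\<sigma> \<subseteq> \<rho>"
          using \<sigma> face_orb_cellD s(2) cells by (metis UnI1 insertCI)
        have "\<rho> \<notin> T" using \<rho> that(2) notin_S by auto
        then show ?thesis using key_less[OF \<sigma>(2) \<rho>(1,3)] \<sigma> \<rho> okey by auto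
      next
        assume "quotient_face s (m s')"
        moreover have "m s' \<in> cells" using cells that(2) by auto
        ultimately obtain \<rho> where \<rho>: "\<rho> \<in> \<Delta>" "m s' = orb \<rho>" "\<sigma> \<subseteq> \<rho>"
          using \<sigma> face_orb_cellD by metis
        obtain \<tau> where \<tau>: "\<tau> \<in> T" "s' = orb (rem \<tau>)" using S_T s(2) by blast
        then have "orb \<rho> = orb \<tau>" using \<rho> m_rem by simp
        then have "\<rho> \<in> T" using \<tau> T_orb by blast
        moreover from this have "s' = orb (rem \<rho>)"
          using orb_rem[OF _ \<tau>(1) \<open>orb \<rho> = orb \<tau>\<close>] \<tau>(2) by simp
        moreover have "\<rho> \<noteq> \<sigma>" using \<open>\<rho> \<in> T\<close> \<sigma> by auto
        moreover have "okey (orb (rem \<rho>)) = key \<rho>"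
          using \<open>\<rho> \<in> T\<close> okey[of "rem \<rho>"] rem_\<Delta> key_rem by simp
        ultimately show ?thesis using key_less[OF \<sigma>(2) \<rho>(1,3)] \<sigma> okey by auto
      qed
    qed
  qed
qed

end

section \<open>Homology of invariant cycles\<close>

context ranked_poset_action
begin

text \<open>The sign with which \<open>\<sigma>\<close> occurs in the boundary of
  \<open>insert x \<sigma>\<close>. The index of \<open>x\<close> can be read off from
  \<open>\<sigma>\<close>, because \<open>x\<close> does not count itself.\<close>

definition sg :: "'a \<Rightarrow> 'a set \<Rightarrow> rat" where
  "sg x \<sigma> = (-1) ^ card {y \<in> \<sigma>. leq y x \<and> y \<noteq> x}"

text \<open>The boundary seen from the facet: the value at \<open>\<sigma>\<close> is collected over
  the vertices that can be added to it. This suits the later argument, which evaluates a boundary at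
  a single free face.\<close>

definition bd :: "('a set \<Rightarrow> rat) \<Rightarrow> 'a set \<Rightarrow> rat" where
  "bd f \<sigma> = (\<Sum>x\<in>P - \<sigma>. f (insert x \<sigma>) * sg x \<sigma>)"

lemma chain_spaceD: "f \<in> chain_space \<Delta> i \<Longrightarrow> f \<sigma> \<noteq> 0 \<Longrightarrow> \<sigma> \<in> \<Delta> \<and> int (card \<sigma>) = i + 1"
  by (simp add: chain_space_def)

lemma boundary_eq_bd:
  assumes "f \<in> chain_space \<Delta> i"
  shows "boundary \<Delta> leq f = bd f"
proof
  fix \<sigma>
  have "boundary \<Delta> leq f \<sigma> = (\<Sum>\<tau>\<in>\<Delta>. \<Sum>x\<in>P. if \<tau> = insert x \<sigma> then (if x \<notin> \<sigma> then f \<tau> * sg x \<sigma> else 0) else 0)"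
    unfolding boundary_def
  proof (intro sum.cong refl)
    fix \<tau> assume \<tau>: "\<tau> \<in> \<Delta>"
    have "f \<tau> * (\<Sum>x\<in>\<tau>. if \<tau> - {x} = \<sigma> then (-1) ^ card {y \<in> \<tau>. leq y x \<and> y \<noteq> x} else 0)
        = (\<Sum>x\<in>\<tau>. if \<tau> = insert x \<sigma> then (if x \<notin> \<sigma> then f \<tau> * sg x \<sigma> else 0) else 0)"
      unfolding sum_distrib_left
    proof (intro sum.cong refl)
      fix x assume x: "x \<in> \<tau>"
      have "{y \<in> insert x \<sigma>. leq y x \<and> y \<noteq> x} = {y \<in> \<sigma>. leq y x \<and> y \<noteq> x}" by auto
      moreover have "\<tau> - {x} = \<sigma> \<longleftrightarrow> \<tau> = insert x \<sigma> \<and> x \<notin> \<sigma>" using x by auto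
      ultimately show "f \<tau> * (if \<tau> - {x} = \<sigma> then (-1) ^ card {y \<in> \<tau>. leq y x \<and> y \<noteq> x} else 0)
        = (if \<tau> = insert x \<sigma> then (if x \<notin> \<sigma> then f \<tau> * sg x \<sigma> else 0) else 0)"
        unfolding sg_def by (simp split: if_split)
    qed
    also have "\<dots> = (\<Sum>x\<in>P. if \<tau> = insert x \<sigma> then (if x \<notin> \<sigma> then f \<tau> * sg x \<sigma> else 0) else 0)"
      using \<tau> by (intro sum.mono_neutral_left) (auto simp: finite_P order_complex_def)
    finally show "f \<tau> * (\<Sum>x\<in>\<tau>. if \<tau> - {x} = \<sigma> then (-1) ^ card {y \<in> \<tau>. leq y x \<and> y \<noteq> x} else 0)
      = (\<Sum>x\<in>P. if \<tau> = insert x \<sigma> then (if x \<notin> \<sigma> then f \<tau> * sg x \<sigma> else 0) else 0)" .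
  qed
  also have "\<dots> = (\<Sum>x\<in>P. \<Sum>\<tau>\<in>\<Delta>. if \<tau> = insert x \<sigma> then (if x \<notin> \<sigma> then f \<tau> * sg x \<sigma> else 0) else 0)"
    by (rule sum.swap)
  also have "\<dots> = (\<Sum>x\<in>P. if x \<notin> \<sigma> then f (insert x \<sigma>) * sg x \<sigma> else 0)"
  proof (intro sum.cong refl)
    fix x
    \<comment> \<open>\<open>bd\<close> also runs over sets that are not simplices; a chain vanishes
      on them.\<close>
    have "f (insert x \<sigma>) = 0" if "insert x \<sigma> \<notin> \<Delta>" using that assms chain_spaceD by blast
    then show "(\<Sum>\<tau>\<in>\<Delta>. if \<tau> = insert x \<sigma> then (if x \<notin> \<sigma> then f \<tau> * sg x \<sigma> else 0) else 0)
      = (if x \<notin> \<sigma> then f (insert x \<sigma>) * sg x \<sigma> else 0)"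
      by (auto simp: sum.delta finite_\<Delta>)
  qed
  also have "\<dots> = bd f \<sigma>"
    unfolding bd_def by (rule sum.mono_neutral_cong_right) (auto simp: finite_P)
  finally show "boundary \<Delta> leq f \<sigma> = bd f \<sigma>" .
qed

section \<open>Linearity of the boundary, its square and its equivariance\<close>

lemma bd_add: "bd (\<lambda>\<sigma>. f \<sigma> + g \<sigma>) \<sigma> = bd f \<sigma> + bd g \<sigma>"
  unfolding bd_def by (simp add: sum.distrib distrib_right)

lemma bd_diff: "bd (\<lambda>\<sigma>. f \<sigma> - g \<sigma>) \<sigma> = bd f \<sigma> - bd g \<sigma>"
  unfolding bd_def by (simp add: sum_subtractf left_diff_distrib)

lemma bd_smult: "bd (\<lambda>\<sigma>. c * f \<sigma>) \<sigma> = c * bd f \<sigma>"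
  unfolding bd_def by (simp add: sum_distrib_left mult.assoc)

lemma bd_zero: "bd (\<lambda>_. 0) \<sigma> = 0"
  unfolding bd_def by simp

lemma bd_sum: "bd (\<lambda>\<sigma>. \<Sum>j\<in>J. f j \<sigma>) \<sigma> = (\<Sum>j\<in>J. bd (f j) \<sigma>)"
  unfolding bd_def by (subst sum.swap) (simp add: sum_distrib_right)

lemma chain_space_zero: "(\<lambda>_. 0) \<in> chain_space \<Delta> i"
  by (simp add: chain_space_def)

lemma chain_space_add: "f \<in> chain_space \<Delta> i \<Longrightarrow> g \<in> chain_space \<Delta> i \<Longrightarrow> (\<lambda>\<sigma>. f \<sigma> + g \<sigma>) \<in> chain_space \<Delta> i"
  unfolding chain_space_def by force

lemma chain_space_diff: "f \<in> chain_space \<Delta> i \<Longrightarrow> g \<in> chain_space \<Delta> i \<Longrightarrow> (\<lambda>\<sigma>. f \<sigma> - g \<sigma>) \<in> chain_space \<Delta> i"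
  unfolding chain_space_def by force

lemma chain_space_smult: "f \<in> chain_space \<Delta> i \<Longrightarrow> (\<lambda>\<sigma>. c * f \<sigma>) \<in> chain_space \<Delta> i"
  unfolding chain_space_def by simp

lemma chain_space_sum: "(\<And>j. j \<in> J \<Longrightarrow> f j \<in> chain_space \<Delta> i) \<Longrightarrow> (\<lambda>\<sigma>. \<Sum>j\<in>J. f j \<sigma>) \<in> chain_space \<Delta> i"
  by (induction J rule: infinite_finite_induct) (simp_all add: chain_space_zero chain_space_add)

lemma chain_space_act:
  assumes "f \<in> chain_space \<Delta> i" "g \<in> carrier G"
  shows "(\<lambda>\<sigma>. f (act g ` \<sigma>)) \<in> chain_space \<Delta> i"
  using assms unfolding chain_space_def by (auto simp: act_\<Delta>_iff card_image_act)

lemma bd_chain_space: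
  assumes "h \<in> chain_space \<Delta> (i + 1)"
  shows "bd h \<in> chain_space \<Delta> i"
  unfolding chain_space_def
proof (intro CollectI allI impI)
  fix \<sigma> assume "bd h \<sigma> \<noteq> 0"
  then obtain x where x: "x \<in> P - \<sigma>" "h (insert x \<sigma>) \<noteq> 0"
    unfolding bd_def by (metis (no_types, lifting) mult_zero_left sum.neutral)
  then have *: "insert x \<sigma> \<in> \<Delta>" "int (card (insert x \<sigma>)) = i + 2"
    using chain_spaceD[OF assms] by auto
  then have "\<sigma> \<in> \<Delta>" using \<Delta>_subset by blast
  moreover from this have "card (insert x \<sigma>) = Suc (card \<sigma>)" using x \<Delta>D by simp
  ultimately show "\<sigma> \<in> \<Delta> \<and> int (card \<sigma>) = i + 1" using * by simp
qed

lemma boundary_space_eq: "boundary_space \<Delta> leq i = bd ` chain_space \<Delta> (i + 1)"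
  unfolding boundary_space_def using boundary_eq_bd by (metis (no_types, lifting) image_cong)

text \<open>Two vertices can be added to \<open>\<rho>\<close> in either order, and the two
  contributions cancel.\<close>

lemma bd_bd:
  assumes f: "f \<in> chain_space \<Delta> i"
  shows "bd (bd f) \<rho> = 0"
proof -
  define a where "a x y = (if x = y then 0 else f (insert y (insert x \<rho>)) * sg y (insert x \<rho>) * sg x \<rho>)" for x y
  have sum_a: "bd (bd f) \<rho> = (\<Sum>x\<in>P - \<rho>. \<Sum>y\<in>P - \<rho>. a x y)"
    unfolding bd_def sum_distrib_right
    by (intro sum.cong refl sum.mono_neutral_cong_left) (auto simp: finite_P a_def)
  have anti: "a x y = - a y x" if xy: "x \<in> P - \<rho>" "y \<in> P - \<rho>" for x y
  proof (cases "x = y \<or> insert y (insert x \<rho>) \<notin> \<Delta>")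
    case True
    then have "x = y \<or> f (insert y (insert x \<rho>)) = 0" using chain_spaceD[OF f] by blast
    then show ?thesis unfolding a_def by (auto simp: insert_commute)
  next
    case False
    then have \<Delta>: "insert y (insert x \<rho>) \<in> \<Delta>" and "x \<noteq> y" by auto
    then have "leq x y \<longleftrightarrow> \<not> leq y x"
      using chain_leq_iff_rk[OF \<Delta>, of x y] chain_leq_iff_rk[OF \<Delta>, of y x] \<Delta>D(3)[OF \<Delta>, of x y] by auto
    \<comment> \<open>Adding the smaller vertex first shifts the index of the larger one, but not
      conversely. Exactly one of the two orders therefore picks up a sign.\<close>
    moreover have *: "sg y' (insert x' \<rho>) = (if leq x' y' then -1 else 1) * sg y' \<rho>"
      if "x' \<notin> \<rho>" "x' \<noteq> y'" for x' y'
    proof (cases "leq x' y'")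
      case True
      have "finite \<rho>" using \<Delta>D(1)[OF \<Delta>] by simp
      moreover have "{z \<in> insert x' \<rho>. leq z y' \<and> z \<noteq> y'} = insert x' {z \<in> \<rho>. leq z y' \<and> z \<noteq> y'}"
        using True that by auto
      ultimately show ?thesis using True that by (simp add: sg_def)
    next
      case False
      then have "{z \<in> insert x' \<rho>. leq z y' \<and> z \<noteq> y'} = {z \<in> \<rho>. leq z y' \<and> z \<noteq> y'}" by auto
      then show ?thesis using False by (simp add: sg_def)
    qed
    ultimately show ?thesis using xy \<open>x \<noteq> y\<close> unfolding a_def
      by (simp add: *[of x y] *[of y x] insert_commute)
  qed
  have "bd (bd f) \<rho> = (\<Sum>x\<in>P - \<rho>. \<Sum>y\<in>P - \<rho>. - a y x)"
    unfolding sum_a by (intro sum.cong refl anti)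
  also have "\<dots> = - (\<Sum>y\<in>P - \<rho>. \<Sum>x\<in>P - \<rho>. a y x)"
    unfolding sum_negf neg_equal_iff_equal by (rule sum.swap)
  also have "\<dots> = - bd (bd f) \<rho>"
    unfolding sum_a by (rule refl)
  finally show ?thesis by simp
qed

lemma sg_act:
  assumes "g \<in> carrier G" "x \<in> P" "\<sigma> \<subseteq> P"
  shows "sg (act g x) (act g ` \<sigma>) = sg x \<sigma>"
proof -
  have "{y \<in> act g ` \<sigma>. leq y (act g x) \<and> y \<noteq> act g x} = act g ` {y \<in> \<sigma>. leq y x \<and> y \<noteq> x}"
    using assms act_leq_iff injD[OF act_inj[OF assms(1)]] by blast
  then show ?thesis unfolding sg_def using card_image_act assms by simp
qed

lemma bd_act:
  assumes f: "f \<in> chain_space \<Delta> i" and g: "g \<in> carrier G"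
  shows "bd (\<lambda>\<sigma>. f (act g ` \<sigma>)) \<sigma> = bd f (act g ` \<sigma>)"
proof (cases "\<sigma> \<subseteq> P")
  case True
  have "bij_betw (act g) (P - \<sigma>) (P - act g ` \<sigma>)"
  proof (rule bij_betw_imageI)
    show "inj_on (act g) (P - \<sigma>)" using act_inj[OF g] by (rule inj_on_subset) simp
    have "act g ` P = P"
      using finite_P act_P[OF g] inj_on_subset[OF act_inj[OF g] subset_UNIV] by (intro endo_inj_surj) auto
    then show "act g ` (P - \<sigma>) = P - act g ` \<sigma>" using image_set_diff[OF act_inj[OF g]] by simp
  qed
  then have "bd f (act g ` \<sigma>) = (\<Sum>x\<in>P - \<sigma>. f (insert (act g x) (act g ` \<sigma>)) * sg (act g x) (act g ` \<sigma>))"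
    unfolding bd_def by (rule sum.reindex_bij_betw[symmetric])
  then show ?thesis using True g by (simp add: bd_def sg_act)
next
  case False
  then have "insert x \<sigma> \<notin> \<Delta>" for x using \<Delta>D(2) by blast
  moreover have "insert x (act g ` \<sigma>) \<notin> \<Delta>" for x
    using False \<Delta>D(2) act_P_iff[OF g] by fastforce
  ultimately have "f (act g ` insert x \<sigma>) = 0" "f (insert x (act g ` \<sigma>)) = 0" for x
    using chain_spaceD[OF f] act_\<Delta>_iff[OF g] by blast+
  then show ?thesis unfolding bd_def by simp
qed

section \<open>Invariant chains along a collapse\<close>

definition G_invariant :: "('a set \<Rightarrow> rat) \<Rightarrow> bool" where
  "G_invariant f \<longleftrightarrow> (\<forall>g\<in>carrier G. \<forall>\<sigma>. f (act g ` \<sigma>) = f \<sigma>)"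

lemma G_invariantD: "G_invariant f \<Longrightarrow> orb \<sigma> = orb \<tau> \<Longrightarrow> f \<sigma> = f \<tau>"
  unfolding G_invariant_def using orb_eq_iff by metis

lemma G_invariant_bd:
  assumes "f \<in> chain_space \<Delta> i" "G_invariant f"
  shows "G_invariant (bd f)"
  unfolding G_invariant_def
proof (intro ballI allI)
  fix g \<sigma> assume g: "g \<in> carrier G"
  then have "(\<lambda>\<sigma>. f (act g ` \<sigma>)) = f" using assms(2) unfolding G_invariant_def by auto
  then show "bd f (act g ` \<sigma>) = bd f \<sigma>" using bd_act[OF assms(1) g, of \<sigma>] by simp
qed

lemma orb_card: "orb \<sigma> = orb \<tau> \<Longrightarrow> card \<sigma> = card \<tau>"
  using orb_eq_iff card_image_act by metis

text \<open>Several translates of one cell may contain the same face \<open>\<sigma>\<close>.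
  Equality of their signs prevents these incidences from cancelling.\<close>

lemma sg_eq_if_same_orbit:
  assumes "insert x \<sigma> \<in> \<Delta>" "orb (insert x \<sigma>) = orb (insert x' \<sigma>)" "x \<notin> \<sigma>" "x' \<notin> \<sigma>"
  shows "sg x \<sigma> = sg x' \<sigma>"
proof -
  obtain g where g: "g \<in> carrier G" "insert x' \<sigma> = act g ` insert x \<sigma>" using assms orb_eq_iff by auto
  have \<Delta>': "insert x' \<sigma> \<in> \<Delta>" using act_\<Delta>[OF g(1) assms(1)] g(2) by metis
  have fin: "finite \<sigma>" and P: "insert x \<sigma> \<subseteq> P" using \<Delta>D[OF assms(1)] by auto
  \<comment> \<open>The sum of the ranks is constant on an orbit of simplices; cancelling the part
    from \<open>\<sigma>\<close> leaves \<open>rk x = rk x'\<close>. In a chain the sign depends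
    only on this rank.\<close>
  have "sum rk (insert x' \<sigma>) = sum (rk \<circ> act g) (insert x \<sigma>)"
    unfolding g(2) by (intro sum.reindex inj_on_subset[OF act_inj[OF g(1)]]) simp
  also have "\<dots> = sum rk (insert x \<sigma>)"
    using P g by (intro sum.cong) (auto simp: rk_act)
  finally have rk: "rk x = rk x'" using fin assms by simp
  have *: "{y \<in> \<sigma>. leq y z \<and> y \<noteq> z} = {y \<in> \<sigma>. rk y < rk z}" if "insert z \<sigma> \<in> \<Delta>" for z
    using chain_leq_iff_rk[OF that] by blast
  show ?thesis unfolding sg_def *[OF assms(1)] *[OF \<Delta>'] rk by (rule refl)
qed

lemma face_trans:
  assumes "t \<in> cells" "quotient_face (orb \<sigma>) (orb \<rho>)" "quotient_face (orb \<rho>) t"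
  shows "quotient_face (orb \<sigma>) t"
proof -
  obtain \<rho>' where \<rho>': "\<rho>' \<in> orb \<rho>" "\<sigma> \<subseteq> \<rho>'" using assms face_orb_iff by auto
  then have "orb \<rho>' = orb \<rho>" using mem_orb_iff by blast
  then obtain \<tau> where \<tau>: "t = orb \<tau>" "\<rho>' \<subseteq> \<tau>" using assms face_orb_cellD by metis
  show ?thesis unfolding \<tau>(1) face_orb_iff using \<tau>(2) \<rho>' orb_self by blast
qed

text \<open>Induction along the collapse, keeping \<open>C\<close> closed under faces. Over the
  rationals the incidence number of a collapsed pair is invertible, so an invariant cycle can be
  pushed off the pair. With \<open>i \<ge> 0\<close> the support avoids the empty chain, which has
  no cell.\<close>

lemma invariant_cycle_is_boundary_aux:
  assumes "(elementary_collapse quotient_face)\<^sup>*\<^sup>* C {v}"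
    and "C \<subseteq> cells" and "\<And>t \<sigma>. t \<in> C \<Longrightarrow> orb \<sigma> \<in> cells \<Longrightarrow> quotient_face (orb \<sigma>) t \<Longrightarrow> orb \<sigma> \<in> C"
    and "f \<in> chain_space \<Delta> i" "i \<ge> 0" "G_invariant f" "\<And>\<sigma>. f \<sigma> \<noteq> 0 \<Longrightarrow> orb \<sigma> \<in> C"
    and "bd f = (\<lambda>_. 0)"
  shows "\<exists>h\<in>chain_space \<Delta> (i + 1). f = bd h"
  using assms
proof (induction C arbitrary: f rule: converse_rtranclp_induct)
  case base
  obtain \<sigma>0 x where \<sigma>0: "v = orb \<sigma>0" "\<sigma>0 \<in> \<Delta>" "x \<in> \<sigma>0"
    using base.prems(1) unfolding cells_eq by blast
  then have x: "x \<in> P" using \<Delta>D by auto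
  then have "orb {x} \<in> cells" using cells_eq singleton_in_\<Delta> by auto
  moreover have "quotient_face (orb {x}) v" unfolding \<sigma>0(1) face_orb_iff using \<sigma>0 orb_self by blast
  \<comment> \<open>As \<open>{v}\<close> is closed under faces, the last cell is an orbit of
    vertices.\<close>
  ultimately have v: "v = orb {x}" using base.prems(2)[of v "{x}"] by simp
  define Y where "Y = {y \<in> P. orb {y} = v}"
  \<comment> \<open>The boundary at the empty chain is the augmentation. It adds up the values of
    \<open>f\<close> over the orbit \<open>Y\<close>, where they all agree.\<close>
  have "0 = bd f {}" using base.prems by simp
  also have "\<dots> = (\<Sum>y\<in>P. f {y})" unfolding bd_def sg_def by simp
  also have "\<dots> = (\<Sum>y\<in>Y. f {x})"
  proof (rule sum.mono_neutral_cong_right[OF finite_P])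
    show "\<forall>y\<in>P - Y. f {y} = 0" unfolding Y_def using base.prems(6) by blast
    show "f {y} = f {x}" if "y \<in> Y" for y
      using that v unfolding Y_def by (intro G_invariantD[OF base.prems(5)]) simp
  qed (auto simp: Y_def)
  finally have "f {x} = 0" using x v finite_P by (auto simp: Y_def)
  then have "f \<sigma> = 0" for \<sigma>
    using base.prems(6)[of \<sigma>] G_invariantD[OF base.prems(5), of \<sigma> "{x}"] v by fastforce
  then have "f = (\<lambda>_. 0)" by (rule ext)
  then show ?case using chain_space_zero bd_zero by (intro bexI[of _ "\<lambda>_. 0"]) (auto simp: fun_eq_iff)
next
  case (step C D)
  note C_sub = step.prems(1) and C_closed = step.prems(2) and f = step.prems(3) and inv_f = step.prems(5)
    and supp_f = step.prems(6)
  obtain s t where st: "s \<in> C" "t \<in> C" "s \<noteq> t" "quotient_face s t" "D = C - {s, t}"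
    and free: "\<And>u. u \<in> C \<Longrightarrow> quotient_face s u \<Longrightarrow> u = s \<or> u = t"
    using step.hyps(1) unfolding elementary_collapse_def by auto
  obtain \<sigma> where \<sigma>: "s = orb \<sigma>" "\<sigma> \<in> \<Delta>" "\<sigma> \<noteq> {}" using st(1) C_sub cells_eq by auto
  obtain \<tau> where \<tau>: "\<tau> \<in> \<Delta>" "t = orb \<tau>" "\<sigma> \<subseteq> \<tau>"
    using face_orb_cellD st(2,4) C_sub \<sigma>(1) by (metis subsetD)
  have "\<sigma> \<noteq> \<tau>" using st \<sigma> \<tau> by auto
  have ins_t: "orb (insert x \<sigma>) = t" if x: "x \<notin> \<sigma>" "orb (insert x \<sigma>) \<in> C" for x
  proof -
    have "card (insert x \<sigma>) \<noteq> card \<sigma>" using x \<sigma> \<Delta>D by simp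
    then have "orb (insert x \<sigma>) \<noteq> s" using orb_card \<sigma> by blast
    moreover have "quotient_face s (orb (insert x \<sigma>))" unfolding \<sigma> face_orb_iff using orb_self by blast
    ultimately show ?thesis using free x by blast
  qed
  obtain x0 where x0: "x0 \<in> \<tau>" "x0 \<notin> \<sigma>" using \<open>\<sigma> \<noteq> \<tau>\<close> \<tau> by auto
  have ins0: "insert x0 \<sigma> \<in> \<Delta>" using \<Delta>_subset \<tau> x0 by (metis insert_subset)
  \<comment> \<open>Adding just one vertex of \<open>\<tau> - \<sigma>\<close> already yields a cell
    of \<open>C\<close> properly above \<open>s\<close>, which can only be \<open>t\<close>. The
    free face thus has codimension one.\<close>
  have x0_t: "orb (insert x0 \<sigma>) = t"
  proof (rule ins_t)
    have "orb (insert x0 \<sigma>) \<in> cells" using ins0 cells_eq by auto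
    moreover have "quotient_face (orb (insert x0 \<sigma>)) t"
      unfolding \<tau> face_orb_iff using orb_self \<tau> x0 by blast
    ultimately show "orb (insert x0 \<sigma>) \<in> C" using C_closed st by blast
  qed (rule x0)
  have card_t: "card \<rho> = Suc (card \<sigma>)" if "orb \<rho> = t" for \<rho>
    using orb_card[of \<rho> "insert x0 \<sigma>"] that x0_t x0 \<sigma> \<Delta>D by simp
  have x0P: "x0 \<in> P" using \<tau> x0 \<Delta>D by auto
  define X where "X = {x \<in> P - \<sigma>. orb (insert x \<sigma>) = t}"
  \<comment> \<open>The incidence number of \<open>\<sigma>\<close> with the orbit \<open>t\<close>:
    the translates of \<open>\<tau>\<close> obtained from \<open>\<sigma>\<close> by adding a
    vertex, all counted with the same sign.\<close>
  define e where "e = of_nat (card X) * sg x0 \<sigma>"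
  have "e \<noteq> 0" using x0 x0P x0_t finite_P unfolding e_def X_def sg_def by auto
  have bd_\<sigma>: "bd u \<sigma> = u \<tau> * e" if u: "G_invariant u" "\<And>\<rho>. u \<rho> \<noteq> 0 \<Longrightarrow> orb \<rho> \<in> C" for u
  proof -
    have "u (insert x \<sigma>) = 0" if "x \<in> P - \<sigma>" "x \<notin> X" for x
      using that u(2) ins_t unfolding X_def by blast
    moreover have "u (insert x \<sigma>) * sg x \<sigma> = u \<tau> * sg x0 \<sigma>" if "x \<in> X" for x
      using that G_invariantD[OF u(1), of "insert x \<sigma>" \<tau>] sg_eq_if_same_orbit[OF ins0, of x] x0 x0_t \<tau>
      unfolding X_def by simp
    ultimately have "bd u \<sigma> = (\<Sum>x\<in>X. u \<tau> * sg x0 \<sigma>)"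
      unfolding bd_def by (intro sum.mono_neutral_cong_right) (auto simp: X_def finite_P)
    then show ?thesis by (simp add: e_def)
  qed
  have f_t: "f \<rho> = 0" if "orb \<rho> = t" for \<rho>
  proof -
    have "f \<tau> * e = 0" using bd_\<sigma>[OF inv_f supp_f] step.prems(7) by simp
    then show ?thesis using \<open>e \<noteq> 0\<close> G_invariantD[OF inv_f, of \<rho> \<tau>] that \<tau> by simp
  qed
  \<comment> \<open>Constant on \<open>t\<close> and zero elsewhere, scaled so that its boundary
    agrees with \<open>f\<close> at \<open>\<sigma>\<close>, and hence on all of \<open>s\<close> by
    invariance.\<close>
  define h where "h \<rho> = (if orb \<rho> = t then f \<sigma> / e else 0)" for \<rho>
  have h_chain: "h \<in> chain_space \<Delta> (i + 1)"
    unfolding chain_space_def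
  proof (intro CollectI allI impI)
    fix \<rho> assume "h \<rho> \<noteq> 0"
    then have \<rho>: "orb \<rho> = t" "f \<sigma> \<noteq> 0" unfolding h_def by (auto split: if_splits)
    then have "\<rho> \<in> \<Delta>" using mem_cellD(2)[of t \<rho>] st C_sub orb_self by blast
    then show "\<rho> \<in> \<Delta> \<and> int (card \<rho>) = i + 1 + 1" using card_t \<rho> chain_spaceD[OF f \<rho>(2)] by simp
  qed
  have h_inv: "G_invariant h" unfolding G_invariant_def h_def by (auto simp: orb_eqI)
  have h_supp: "orb \<rho> \<in> C" if "h \<rho> \<noteq> 0" for \<rho> using that st unfolding h_def by (auto split: if_splits)
  have bd_h_\<sigma>: "bd h \<sigma> = f \<sigma>" using bd_\<sigma>[OF h_inv h_supp] \<open>e \<noteq> 0\<close> \<tau> by (simp add: h_def)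
  have bd_h_chain: "bd h \<in> chain_space \<Delta> i" by (rule bd_chain_space[OF h_chain])
  have bd_h_supp: "orb \<rho> \<in> C \<and> orb \<rho> \<noteq> t" if "bd h \<rho> \<noteq> 0" for \<rho>
  proof -
    have \<rho>: "\<rho> \<in> \<Delta>" "\<rho> \<noteq> {}" using chain_spaceD[OF bd_h_chain that] \<open>i \<ge> 0\<close> by auto
    have "\<exists>x\<in>P - \<rho>. orb (insert x \<rho>) = t"
      using that unfolding bd_def h_def by (rule contrapos_np) (simp add: sum.neutral)
    then obtain x where x: "x \<in> P - \<rho>" "orb (insert x \<rho>) = t" by blast
    have "quotient_face (orb \<rho>) t" unfolding x(2)[symmetric] face_orb_iff using orb_self by blast
    moreover have "orb \<rho> \<in> cells" using \<rho> cells_eq by auto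
    moreover have "card (insert x \<rho>) = Suc (card \<rho>)" using \<rho> x \<Delta>D by simp
    ultimately show ?thesis using C_closed st(2) card_t x by (metis n_not_Suc_n)
  qed
  define f' where "f' \<rho> = f \<rho> - bd h \<rho>" for \<rho>
  have "\<exists>h'\<in>chain_space \<Delta> (i + 1). f' = bd h'"
  proof (rule step.IH)
    show "D \<subseteq> cells" using st C_sub by auto
    show "orb \<rho> \<in> D" if "u \<in> D" "orb \<rho> \<in> cells" "quotient_face (orb \<rho>) u" for u \<rho>
    proof -
      have u: "u \<in> C" "u \<noteq> s" "u \<noteq> t" "u \<in> cells" using that st C_sub by auto
      have "orb \<rho> \<noteq> s" using free u that by blast
      \<comment> \<open>A remaining cell above \<open>t\<close> would also lie above
        \<open>s\<close>, contrary to freeness.\<close>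
      moreover have "orb \<rho> \<noteq> t"
        using free[OF u(1)] u face_trans[OF u(4), of \<sigma> \<rho>] that st \<sigma> by metis
      ultimately show ?thesis using C_closed[OF u(1)] that st by blast
    qed
    show "f' \<in> chain_space \<Delta> i" unfolding f'_def by (rule chain_space_diff[OF f bd_h_chain])
    show inv_f': "G_invariant f'"
      using inv_f G_invariant_bd[OF h_chain h_inv] unfolding f'_def G_invariant_def by simp
    show "orb \<rho> \<in> D" if "f' \<rho> \<noteq> 0" for \<rho>
    proof -
      have "orb \<rho> \<noteq> s" using G_invariantD[OF inv_f', of \<rho> \<sigma>] that bd_h_\<sigma> \<sigma> by (auto simp: f'_def)
      moreover have "f \<rho> \<noteq> 0 \<or> bd h \<rho> \<noteq> 0" using that by (auto simp: f'_def)
      ultimately show ?thesis using f_t supp_f bd_h_supp st by blast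
    qed
    show "bd f' = (\<lambda>_. 0)" unfolding f'_def using step.prems(7) bd_bd[OF h_chain] by (simp add: bd_diff fun_eq_iff)
  qed (use \<open>i \<ge> 0\<close> in simp)
  then obtain h' where h': "h' \<in> chain_space \<Delta> (i + 1)" "f' = bd h'" by blast
  have "f = bd (\<lambda>\<rho>. h \<rho> + h' \<rho>)"
    using fun_cong[OF h'(2)] by (simp add: fun_eq_iff bd_add f'_def algebra_simps)
  then show ?case using chain_space_add[OF h_chain h'(1)] by blast
qed

lemma invariant_cycle_is_boundary:
  assumes "collapsible cells quotient_face"
    and f: "f \<in> chain_space \<Delta> i" "G_invariant f" "bd f = (\<lambda>_. 0)"
  shows "\<exists>h\<in>chain_space \<Delta> (i + 1). f = bd h"
proof -
  obtain v where v: "v \<in> cells" "(elementary_collapse quotient_face)\<^sup>*\<^sup>* cells {v}"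
    using assms(1) unfolding collapsible_def by blast
  show ?thesis
  proof (cases "i \<ge> 0")
    case True
    show ?thesis
    proof (rule invariant_cycle_is_boundary_aux[OF v(2) subset_refl _ f(1) True f(2) _ f(3)])
      show "orb \<sigma> \<in> cells" if "f \<sigma> \<noteq> 0" for \<sigma>
        using chain_spaceD[OF f(1) that] True unfolding cells_eq by auto
    qed
  next
    case False
    \<comment> \<open>In negative degree only the empty chain can carry a value. A multiple of any
      vertex has the required boundary.\<close>
    obtain x where x: "x \<in> P" using v(1) cells_eq \<Delta>D(2) by fastforce
    define h where "h \<rho> = (if \<rho> = {x} then f {} else 0)" for \<rho>
    have f0: "f \<rho> = 0" if "\<rho> \<noteq> {}" for \<rho>
    proof (rule ccontr)
      assume "f \<rho> \<noteq> 0"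
      then have "\<rho> \<in> \<Delta>" "int (card \<rho>) \<le> 0" using chain_spaceD[OF f(1)] False by auto
      then show False using that \<Delta>D by auto
    qed
    have "bd h \<rho> = f \<rho>" for \<rho>
    proof (cases "\<rho> = {}")
      case True
      have "bd h {} = (\<Sum>y\<in>P. if y = x then f {} else 0)" unfolding bd_def h_def sg_def by (intro sum.cong) auto
      then show ?thesis using True x finite_P by simp
    next
      case False
      then have "h (insert y \<rho>) = 0" if "y \<in> P - \<rho>" for y using that unfolding h_def by auto
      then show ?thesis using f0[OF False] unfolding bd_def by simp
    qed
    moreover have "h \<in> chain_space \<Delta> (i + 1)"
      using chain_spaceD[OF f(1), of "{}"] x singleton_in_\<Delta> unfolding chain_space_def h_def by auto
    ultimately show ?thesis by (intro bexI[of _ h]) auto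
  qed
qed

text \<open>A group element permutes the simplices, so the push-forward has a single term, the
  pull-back along the inverse. Pull-backs are easier to handle and replace \<open>chain_map\<close>
  below.\<close>

lemma chain_map_act:
  assumes "f \<in> chain_space \<Delta> i" "g \<in> carrier G"
  shows "chain_map \<Delta> (act g) f \<sigma> = f (act (inv g) ` \<sigma>)"
proof -
  have "act g ` \<tau> = \<sigma> \<longleftrightarrow> \<tau> = act (inv g) ` \<sigma>" for \<tau>
    using image_act_inv[OF assms(2)] by metis
  then have "{\<tau> \<in> \<Delta>. act g ` \<tau> = \<sigma>} = (if act (inv g) ` \<sigma> \<in> \<Delta> then {act (inv g) ` \<sigma>} else {})"
    by auto
  moreover have "f (act (inv g) ` \<sigma>) = 0" if "act (inv g) ` \<sigma> \<notin> \<Delta>"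
    using that chain_spaceD[OF assms(1)] by blast
  ultimately show ?thesis unfolding chain_map_def by simp
qed

section \<open>Invariant homology classes and the trivial multiplicity\<close>

lemma cycle_space_iff: "f \<in> cycle_space \<Delta> leq i \<longleftrightarrow> f \<in> chain_space \<Delta> i \<and> bd f = (\<lambda>_. 0)"
  unfolding cycle_space_def using boundary_eq_bd by auto

lemma boundary_is_cycle: "b \<in> boundary_space \<Delta> leq i \<Longrightarrow> b \<in> cycle_space \<Delta> leq i"
  unfolding boundary_space_eq cycle_space_iff using bd_chain_space bd_bd by (auto simp: fun_eq_iff)

lemma zero_in_boundary_space: "(\<lambda>_. 0) \<in> boundary_space \<Delta> leq i"
  unfolding boundary_space_eq using chain_space_zero bd_zero by (intro image_eqI[of _ _ "\<lambda>_. 0"]) auto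

lemma boundary_space_add:
  "b \<in> boundary_space \<Delta> leq i \<Longrightarrow> c \<in> boundary_space \<Delta> leq i \<Longrightarrow> (\<lambda>\<sigma>. b \<sigma> + c \<sigma>) \<in> boundary_space \<Delta> leq i"
  unfolding boundary_space_eq
proof clarify
  fix h k assume hk: "h \<in> chain_space \<Delta> (i + 1)" "k \<in> chain_space \<Delta> (i + 1)"
  show "(\<lambda>\<sigma>. bd h \<sigma> + bd k \<sigma>) \<in> bd ` chain_space \<Delta> (i + 1)"
    by (rule image_eqI[OF _ chain_space_add[OF hk]]) (simp add: fun_eq_iff bd_add)
qed

lemma boundary_space_smult:
  "b \<in> boundary_space \<Delta> leq i \<Longrightarrow> (\<lambda>\<sigma>. a * b \<sigma>) \<in> boundary_space \<Delta> leq i"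
  unfolding boundary_space_eq
  by (clarify, rule image_eqI[OF _ chain_space_smult]) (auto simp: bd_smult)

lemma boundary_space_sum:
  "(\<And>j. j \<in> J \<Longrightarrow> b j \<in> boundary_space \<Delta> leq i) \<Longrightarrow> (\<lambda>\<sigma>. \<Sum>j\<in>J. b j \<sigma>) \<in> boundary_space \<Delta> leq i"
  by (induction J rule: infinite_finite_induct) (simp_all add: zero_in_boundary_space boundary_space_add)

lemma homologous_zero: "homologous \<Delta> leq i `` {\<lambda>_. 0} = boundary_space \<Delta> leq i"
proof -
  have "b \<in> boundary_space \<Delta> leq i \<longleftrightarrow> (\<lambda>\<sigma>. 0 - b \<sigma>) \<in> boundary_space \<Delta> leq i" for b
    using boundary_space_smult[of b i "-1"] boundary_space_smult[of "\<lambda>\<sigma>. - b \<sigma>" i "-1"] by auto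
  then show ?thesis unfolding homologous_def
    using boundary_is_cycle zero_in_boundary_space by auto
qed

lemma homologous_refl: "f \<in> cycle_space \<Delta> leq i \<Longrightarrow> (f, f) \<in> homologous \<Delta> leq i"
  unfolding homologous_def using zero_in_boundary_space by simp

lemma invariant_class_zero:
  assumes coll: "collapsible cells quotient_face"
    and K: "K \<in> carrier (reduced_homology \<Delta> leq i)"
    and inv_K: "\<And>g. g \<in> carrier G \<Longrightarrow> homology_map \<Delta> leq i (act g) K = K"
  shows "K = boundary_space \<Delta> leq i"
proof -
  obtain f where f: "f \<in> cycle_space \<Delta> leq i" "K = homologous \<Delta> leq i `` {f}"
    using K unfolding reduced_homology_def by (auto elim: quotientE)
  have f_chain: "f \<in> chain_space \<Delta> i" and bd_f: "bd f = (\<lambda>_. 0)" using f cycle_space_iff by auto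
  define F where "F \<sigma> = (\<Sum>g\<in>carrier G. f (act g ` \<sigma>))" for \<sigma>
  have act_cycle: "(\<lambda>\<sigma>. f (act g ` \<sigma>)) \<in> cycle_space \<Delta> leq i" if "g \<in> carrier G" for g
    using that chain_space_act[OF f_chain] bd_act[OF f_chain] bd_f unfolding cycle_space_iff by auto
  \<comment> \<open>The pull-back along \<open>g\<close> represents the image of \<open>K\<close>
    under \<open>inv g\<close>, which is \<open>K\<close> again; two representatives of one class
    differ by a boundary.\<close>
  have diff: "(\<lambda>\<sigma>. f \<sigma> - f (act g ` \<sigma>)) \<in> boundary_space \<Delta> leq i" if g: "g \<in> carrier G" for g
  proof -
    have "chain_map \<Delta> (act (inv g)) f = (\<lambda>\<sigma>. f (act g ` \<sigma>))"
      using chain_map_act[OF f_chain, of "inv g"] g by auto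
    moreover have "f \<in> K" using homologous_refl f by auto
    ultimately have "(\<lambda>\<sigma>. f (act g ` \<sigma>)) \<in> chain_map \<Delta> (act (inv g)) ` K" by (metis image_eqI)
    then have "(\<lambda>\<sigma>. f (act g ` \<sigma>)) \<in> homology_map \<Delta> leq i (act (inv g)) K"
      unfolding homology_map_def using homologous_refl[OF act_cycle[OF g]] by blast
    then have "(\<lambda>\<sigma>. f (act g ` \<sigma>)) \<in> homologous \<Delta> leq i `` {f}" using inv_K g f by simp
    then show ?thesis unfolding homologous_def by simp
  qed
  have "F \<in> chain_space \<Delta> i"
    unfolding F_def using chain_space_act[OF f_chain] by (intro chain_space_sum)
  moreover have "bd F = (\<lambda>_. 0)"
    unfolding F_def using bd_act[OF f_chain] bd_f by (simp add: fun_eq_iff bd_sum)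
  moreover have "G_invariant F"
    unfolding G_invariant_def
  proof (intro ballI allI)
    fix h \<sigma> assume h: "h \<in> carrier G"
    have "F (act h ` \<sigma>) = (\<Sum>g\<in>carrier G. f (act (g \<otimes> h) ` \<sigma>))"
      unfolding F_def using h by (intro sum.cong) (auto simp: act_mult image_image)
    also have "\<dots> = F \<sigma>"
      unfolding F_def using h
      by (intro sum.reindex_bij_witness[of _ "\<lambda>g. g \<otimes> inv h" "\<lambda>g. g \<otimes> h"]) (auto simp: m_assoc)
    finally show "F (act h ` \<sigma>) = F \<sigma>" .
  qed
  ultimately have "F \<in> boundary_space \<Delta> leq i"
    using invariant_cycle_is_boundary[OF coll] unfolding boundary_space_eq by blast
  \<comment> \<open>In this sum the translates cancel against \<open>F\<close>, leaving the group
    order times \<open>f\<close>. Dividing by the order requires rational coefficients.\<close>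
  then have "(\<lambda>\<sigma>. (\<Sum>g\<in>carrier G. f \<sigma> - f (act g ` \<sigma>)) + F \<sigma>) \<in> boundary_space \<Delta> leq i"
    using boundary_space_sum[of "carrier G"] diff by (intro boundary_space_add) auto
  then have "(\<lambda>\<sigma>. of_nat (card (carrier G)) * f \<sigma>) \<in> boundary_space \<Delta> leq i"
    by (simp add: F_def sum_subtractf)
  then have "(\<lambda>\<sigma>. (1 / of_nat (card (carrier G))) * (of_nat (card (carrier G)) * f \<sigma>)) \<in> boundary_space \<Delta> leq i"
    by (rule boundary_space_smult)
  moreover have "card (carrier G) \<noteq> 0" using finite_carrier one_closed by auto
  ultimately have fb: "f \<in> boundary_space \<Delta> leq i" by simp
  have "(\<lambda>\<sigma>. f \<sigma> - b \<sigma>) \<in> boundary_space \<Delta> leq i \<longleftrightarrow> b \<in> boundary_space \<Delta> leq i" for b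
    using boundary_space_add[OF fb boundary_space_smult[of b i "-1"]]
      boundary_space_add[OF fb boundary_space_smult[of "\<lambda>\<sigma>. f \<sigma> - b \<sigma>" i "-1"]] by auto
  then show ?thesis unfolding f homologous_def using f boundary_is_cycle by auto
qed

lemma trivial_multiplicity_zero:
  assumes coll: "collapsible cells quotient_face"
  shows "trivial_multiplicity G (\<lambda>g. homology_map \<Delta> leq i (act g)) (reduced_homology \<Delta> leq i) = 0"
proof -
  let ?V = "reduced_homology \<Delta> leq i" and ?B = "boundary_space \<Delta> leq i"
  have smult_B: "c \<odot>\<^bsub>?V\<^esub> ?B = ?B" for c
  proof -
    have 1: "{(\<lambda>\<sigma>. c * f \<sigma>) | f. f \<in> ?B} \<subseteq> ?B" using boundary_space_smult by auto
    \<comment> \<open>For \<open>c = 0\<close> the scaled set consists of the zero chain only, but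
      the class of that chain is still all of \<open>?B\<close>.\<close>
    have "(\<lambda>_. 0) \<in> {(\<lambda>\<sigma>. c * f \<sigma>) | f. f \<in> ?B}"
      using zero_in_boundary_space by (intro CollectI exI[of _ "\<lambda>_. 0"]) simp
    then have "?B \<subseteq> homologous \<Delta> leq i `` {(\<lambda>\<sigma>. c * f \<sigma>) | f. f \<in> ?B}"
      using homologous_zero[of i] by auto
    moreover have "b \<in> ?B" if "a \<in> ?B" "(a, b) \<in> homologous \<Delta> leq i" for a b
      using that boundary_space_add[OF that(1) boundary_space_smult[of "\<lambda>\<sigma>. a \<sigma> - b \<sigma>" i "-1"]]
      unfolding homologous_def by auto
    ultimately show ?thesis using 1 unfolding reduced_homology_def by auto
  qed
  have "m = 0" if v: "\<forall>j<m. v j \<in> carrier ?V \<and> (\<forall>g\<in>carrier G. homology_map \<Delta> leq i (act g) (v j) = v j)"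
    and W: "submodule W rat_field ?V"
    and bij: "bij_betw (\<lambda>(c, w). (\<Oplus>\<^bsub>?V\<^esub>j\<in>{..<m}. c j \<odot>\<^bsub>?V\<^esub> v j) \<oplus>\<^bsub>?V\<^esub> w)
         (({..<m} \<rightarrow>\<^sub>E (UNIV :: rat set)) \<times> W) (carrier ?V)" for m :: nat and v W
  proof (rule ccontr)
    assume "m \<noteq> 0"
    then have v0: "v 0 = ?B" using invariant_class_zero[OF coll, of "v 0" i] v by simp
    obtain w where w: "w \<in> W" using subgroup.one_closed[OF submodule.axioms(1)[OF W]] by blast
    \<comment> \<open>\<open>c\<close> and \<open>c'\<close> differ only in the coefficient of
      \<open>v 0\<close>, which is the zero class. They express the same vector, against uniqueness
      of the expression.\<close>
    define c :: "nat \<Rightarrow> rat" where "c = (\<lambda>j\<in>{..<m}. 0)"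
    define c' where "c' = c(0 := 1)"
    have "c j \<odot>\<^bsub>?V\<^esub> v j = c' j \<odot>\<^bsub>?V\<^esub> v j" for j
      unfolding c'_def using v0 smult_B by simp
    moreover have "(c, w) \<in> ({..<m} \<rightarrow>\<^sub>E UNIV) \<times> W" "(c', w) \<in> ({..<m} \<rightarrow>\<^sub>E UNIV) \<times> W"
      using w \<open>m \<noteq> 0\<close> unfolding c'_def c_def by (auto simp: PiE_iff extensional_def)
    ultimately have "(c, w) = (c', w)"
      by (intro inj_onD[OF bij_betw_imp_inj_on[OF bij]]) simp_all
    then show False using \<open>m \<noteq> 0\<close> by (auto simp: c'_def c_def fun_eq_iff dest: spec[of _ 0])
  qed
  then have "{enat m | m v W.
       (\<forall>j<m. v j \<in> carrier ?V \<and> (\<forall>g\<in>carrier G. homology_map \<Delta> leq i (act g) (v j) = v j)) \<and>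
       submodule W rat_field ?V \<and> (\<forall>g\<in>carrier G. homology_map \<Delta> leq i (act g) ` W \<subseteq> W) \<and>
       bij_betw (\<lambda>(c, w). (\<Oplus>\<^bsub>?V\<^esub>j\<in>{..<m}. c j \<odot>\<^bsub>?V\<^esub> v j) \<oplus>\<^bsub>?V\<^esub> w)
         (({..<m} \<rightarrow>\<^sub>E (UNIV :: rat set)) \<times> W) (carrier ?V)} \<subseteq> {0}"
    by (auto simp: zero_enat_def)
  then have "trivial_multiplicity G (\<lambda>g. homology_map \<Delta> leq i (act g)) ?V \<le> Sup {0}"
    unfolding trivial_multiplicity_def by (rule Sup_subset_mono)
  then show ?thesis by simp
qed

end

section \<open>Partitions into blocks of size 1 and k\<close>

text \<open>Bijections between fibres of equal size are glued together. The labels will encode what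
  a conjugating permutation must respect, so that its existence reduces to counting blocks.\<close>

lemma labelled_bij_betw_exists:
  assumes "finite Y" "finite Y'"
    and "\<And>l. card {D \<in> Y. f D = l} = card {D \<in> Y'. f' D = l}"
  shows "\<exists>\<phi>. bij_betw \<phi> Y Y' \<and> (\<forall>D\<in>Y. f' (\<phi> D) = f D)"
proof -
  have "\<exists>h. bij_betw h {D \<in> Y. f D = l} {D \<in> Y'. f' D = l}" for l
    using assms by (intro finite_same_card_bij) auto
  then obtain h where h: "\<And>l. bij_betw (h l) {D \<in> Y. f D = l} {D \<in> Y'. f' D = l}" by metis
  define \<phi> where "\<phi> D = h (f D) D" for D
  have \<phi>: "\<phi> D \<in> Y'" "f' (\<phi> D) = f D" if "D \<in> Y" for D
    using bij_betw_apply[OF h[of "f D"], of D] that unfolding \<phi>_def by auto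
  have "bij_betw \<phi> Y Y'"
    unfolding bij_betw_def
  proof (intro conjI inj_onI equalityI subsetI)
    fix D E assume DE: "D \<in> Y" "E \<in> Y" "\<phi> D = \<phi> E"
    then have eq: "f D = f E" using \<phi>(2)[of D] \<phi>(2)[of E] by simp
    show "D = E"
      by (rule inj_onD[OF bij_betw_imp_inj_on[OF h[of "f E"]]]) (use DE eq in \<open>auto simp: \<phi>_def\<close>)
  next
    fix E assume "E \<in> Y'"
    then have "E \<in> h (f' E) ` {D \<in> Y. f D = f' E}"
      using bij_betw_imp_surj_on[OF h[of "f' E"]] by simp
    then obtain D where D: "D \<in> Y" "f D = f' E" "E = h (f' E) D" by auto
    then have "E = \<phi> D" unfolding \<phi>_def by simp
    then show "E \<in> \<phi> ` Y" using D(1) by (rule image_eqI)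
  qed (use \<phi> in auto)
  then show ?thesis using \<phi> by blast
qed

lemma partition_on_block_unique:
  assumes "partition_on A x" "B \<in> x" "B' \<in> x" "a \<in> B" "a \<in> B'"
  shows "B = B'"
  using assms unfolding partition_on_def by (meson disjointD disjoint_iff)

text \<open>Bijections from each block \<open>D\<close> to \<open>\<phi> D\<close> fit together
  because the blocks are disjoint and cover \<open>A\<close>. All conjugating permutations below
  arise in this way.\<close>

lemma permutation_lifting_block_bij:
  assumes fin: "finite A" and y: "partition_on A y" and y': "partition_on A y'"
    and \<phi>: "bij_betw \<phi> y y'" and card_\<phi>: "\<And>D. D \<in> y \<Longrightarrow> card (\<phi> D) = card D"
  shows "\<exists>g. g permutes A \<and> (\<forall>D\<in>y. g ` D = \<phi> D)"
proof -
  have fin_y: "finite D" if "D \<in> y \<union> y'" for D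
    using that fin y y' unfolding partition_on_def by (auto intro: finite_subset)
  have \<phi>_y': "\<phi> D \<in> y'" if "D \<in> y" for D using \<phi> that bij_betw_apply by metis
  have "\<exists>h. bij_betw h D (\<phi> D)" if "D \<in> y" for D
    using that fin_y card_\<phi> \<phi>_y' by (intro finite_same_card_bij) auto
  then obtain h where h: "\<And>D. D \<in> y \<Longrightarrow> bij_betw (h D) D (\<phi> D)" by metis
  define blk where "blk a = (THE D. D \<in> y \<and> a \<in> D)" for a
  have blk: "blk a = D" if "D \<in> y" "a \<in> D" for a D
    unfolding blk_def using that partition_on_block_unique[OF y] by (intro the_equality) auto
  define g where "g a = (if a \<in> A then h (blk a) a else a)" for a
  have g: "g a = h D a" if "D \<in> y" "a \<in> D" for a D
    using that blk partition_onD1[OF y] unfolding g_def by auto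
  have g_img: "g ` D = \<phi> D" if "D \<in> y" for D
    using bij_betw_imp_surj_on[OF h[OF that]] g[OF that] by (auto simp: image_iff)
  have "g permutes A"
  proof (rule bij_imp_permutes)
    have "g ` A = (\<Union>D\<in>y. g ` D)" using partition_onD1[OF y] by auto
    also have "\<dots> = \<Union>y'" using g_img bij_betw_imp_surj_on[OF \<phi>] by auto
    finally have "g ` A = A" using partition_onD1[OF y'] by simp
    then show "bij_betw g A A"
      using fin by (simp add: bij_betw_def eq_card_imp_inj_on)
  qed (simp add: g_def)
  then show ?thesis using g_img by blast
qed

section \<open>Set partitions of k-type and the action of permutations\<close>

definition kblocks :: "nat \<Rightarrow> nat set set \<Rightarrow> nat set set" where
  "kblocks k \<tau> = {B \<in> \<tau>. card B = k}"

definition ktype :: "nat \<Rightarrow> nat set set \<Rightarrow> bool" where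
  "ktype k \<tau> \<longleftrightarrow> (\<forall>B\<in>\<tau>. card B = 1 \<or> card B = k)"

text \<open>The number of parts \<open>k\<close> in \<open>gamma k\<close> of the type of
  \<open>x\<close>. It is also the largest number of disjoint k-subsets that fit into the blocks of
  \<open>x\<close>, by \<open>card_packing_le\<close> and \<open>packing_extend\<close>.\<close>

definition max_kblocks :: "nat \<Rightarrow> nat set set \<Rightarrow> nat" where
  "max_kblocks k x = (\<Sum>B\<in>x. card B div k)"

context
  fixes g :: "nat \<Rightarrow> nat" and A :: "nat set"
  assumes g: "g permutes A"
begin

lemma inj_image_permutes: "inj ((`) g)"
  using g by (intro injI) (simp add: inj_image_eq_iff permutes_inj)

lemma card_image_permutes: "card (g ` B) = card B"
  using g by (meson card_image inj_on_subset permutes_inj subset_UNIV)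

lemma partition_on_permute: "partition_on A \<tau> \<Longrightarrow> partition_on A (permute_partition g \<tau>)"
proof -
  assume \<tau>: "partition_on A \<tau>"
  then have "(`) g ` \<tau> - {{}} = (`) g ` \<tau>" using partition_onD3[OF \<tau>] by auto
  then show ?thesis
    using partition_on_inj_image[OF \<tau> permutes_inj_on[OF g]] permutes_image[OF g]
    unfolding permute_partition_def by simp
qed

lemma refines_permute: "refines A \<tau> x \<Longrightarrow> refines A (permute_partition g \<tau>) (permute_partition g x)"
  unfolding refines_def using partition_on_permute
  by (auto simp: permute_partition_def) (meson image_mono)

lemma partition_type_permute: "partition_type (permute_partition g \<tau>) = partition_type \<tau>"
proof -
  have "mset_set (permute_partition g \<tau>) = image_mset ((`) g) (mset_set \<tau>)"
    unfolding permute_partition_def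
    by (rule image_mset_mset_set[symmetric]) (rule inj_on_subset[OF inj_image_permutes], simp)
  then show ?thesis unfolding partition_type_def by (simp add: card_image_permutes image_mset.compositionality comp_def)
qed

lemma kblocks_permute: "kblocks k (permute_partition g \<tau>) = permute_partition g (kblocks k \<tau>)"
  unfolding kblocks_def permute_partition_def by (auto simp: card_image_permutes)

lemma ktype_permute: "ktype k (permute_partition g \<tau>) \<longleftrightarrow> ktype k \<tau>"
  unfolding ktype_def permute_partition_def by (simp add: card_image_permutes)

lemma card_permute: "card (permute_partition g \<tau>) = card \<tau>"
  unfolding permute_partition_def by (rule card_image) (rule inj_on_subset[OF inj_image_permutes], simp)

end

locale k_partitions =
  fixes A :: "nat set" and k :: nat
  assumes finite_A: "finite A" and k2: "2 \<le> k"
begin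

text \<open>The possible sets of k-blocks of a k-type partition. By
  \<open>packing_partition\<close>, \<open>ktype_eqI\<close> and \<open>refines_ktype_iff\<close>
  they correspond to these partitions, with inclusion in place of refinement, so greedy arguments
  can work with families of subsets.\<close>

definition packing :: "nat set set \<Rightarrow> bool" where
  "packing F \<longleftrightarrow> disjoint F \<and> (\<forall>D\<in>F. D \<subseteq> A \<and> card D = k)"

lemma finite_partition: "partition_on A \<tau> \<Longrightarrow> finite \<tau>"
  using finite_elements finite_A by blast

lemma finite_block: "partition_on A \<tau> \<Longrightarrow> B \<in> \<tau> \<Longrightarrow> finite B"
  using finite_A unfolding partition_on_def by (auto intro: finite_subset)

lemma finite_packing: "packing F \<Longrightarrow> finite F"
  unfolding packing_def using finite_A by (auto intro: finite_subset[of F "Pow A"])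

lemma packing_kblocks: "partition_on A \<tau> \<Longrightarrow> packing (kblocks k \<tau>)"
  unfolding packing_def kblocks_def partition_on_def
  by (auto intro: pairwise_subset)

lemma ktype_decomp:
  assumes "partition_on A \<tau>" "ktype k \<tau>"
  shows "\<tau> = kblocks k \<tau> \<union> (\<lambda>a. {a}) ` (A - \<Union>(kblocks k \<tau>))"
proof (intro equalityI subsetI)
  fix B assume B: "B \<in> \<tau>"
  show "B \<in> kblocks k \<tau> \<union> (\<lambda>a. {a}) ` (A - \<Union>(kblocks k \<tau>))"
  proof (cases "card B = k")
    case False
    then obtain a where a: "B = {a}" using B assms(2) card_1_singletonE unfolding ktype_def by metis
    moreover have "a \<notin> D" if "D \<in> kblocks k \<tau>" for D
      using partition_on_block_unique[OF assms(1) B, of D a] that a False unfolding kblocks_def by auto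
    moreover have "a \<in> A" using a B partition_onD1[OF assms(1)] by auto
    ultimately show ?thesis by auto
  qed (use B in \<open>auto simp: kblocks_def\<close>)
next
  fix B assume "B \<in> kblocks k \<tau> \<union> (\<lambda>a. {a}) ` (A - \<Union>(kblocks k \<tau>))"
  then consider "B \<in> kblocks k \<tau>" | a where "B = {a}" "a \<in> A" "a \<notin> \<Union>(kblocks k \<tau>)" by auto
  then show "B \<in> \<tau>"
  proof cases
    case 2
    then obtain C where C: "C \<in> \<tau>" "a \<in> C" using partition_onD1[OF assms(1)] by auto
    then have "card C = 1" using 2 assms(2) unfolding ktype_def kblocks_def by auto
    then have "C = {a}" using C(2) by (metis card_1_singletonE singletonD)
    then show ?thesis using C 2 by simp
  qed (simp add: kblocks_def)
qed

lemma ktype_eqI: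
  assumes "partition_on A \<tau>" "ktype k \<tau>" "partition_on A \<tau>'" "ktype k \<tau>'" "kblocks k \<tau> = kblocks k \<tau>'"
  shows "\<tau> = \<tau>'"
  using ktype_decomp[OF assms(1,2)] ktype_decomp[OF assms(3,4)] assms(5) by simp

lemma packing_partition:
  assumes F: "packing F"
  obtains \<tau> where "partition_on A \<tau>" "ktype k \<tau>" "kblocks k \<tau> = F"
proof
  let ?\<tau> = "F \<union> (\<lambda>a. {a}) ` (A - \<Union>F)"
  have Fk: "D \<subseteq> A" "card D = k" if "D \<in> F" for D using F that unfolding packing_def by auto
  show "partition_on A ?\<tau>"
  proof (rule partition_onI)
    show "\<Union>?\<tau> = A" using Fk by auto
    show "{} \<notin> ?\<tau>" using Fk(2) k2 by fastforce
    show "disjnt p q" if "p \<in> ?\<tau>" "q \<in> ?\<tau>" "p \<noteq> q" for p q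
    proof (cases "p \<in> F \<and> q \<in> F")
      case True
      then show ?thesis using disjointD[of F p q] that(3) F unfolding packing_def disjnt_def by blast
    qed (use that in \<open>auto simp: disjnt_def\<close>)
  qed
  show "ktype k ?\<tau>" unfolding ktype_def using Fk by auto
  show "kblocks k ?\<tau> = F" unfolding kblocks_def using Fk k2 by auto
qed

lemma refines_ktypeI:
  assumes "partition_on A \<tau>" "ktype k \<tau>" "partition_on A x"
    and "\<And>D. D \<in> kblocks k \<tau> \<Longrightarrow> \<exists>B\<in>x. D \<subseteq> B"
  shows "refines A \<tau> x"
  unfolding refines_def
proof (intro conjI ballI assms(1,3))
  fix D assume "D \<in> \<tau>"
  then have "D \<in> kblocks k \<tau> \<or> (\<exists>a\<in>A. D = {a})" using ktype_decomp[OF assms(1,2)] by auto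
  then show "\<exists>B\<in>x. D \<subseteq> B" using assms(4) partition_onD1[OF assms(3)] by auto
qed

text \<open>Since \<open>2 \<le> k\<close>, a k-block fits into no singleton. It lies in a block of
  size \<open>k\<close> and coincides with it.\<close>

lemma refines_ktype_iff:
  assumes "partition_on A \<tau>" "ktype k \<tau>" "partition_on A \<tau>'" "ktype k \<tau>'"
  shows "refines A \<tau> \<tau>' \<longleftrightarrow> kblocks k \<tau> \<subseteq> kblocks k \<tau>'"
proof
  assume r: "refines A \<tau> \<tau>'"
  show "kblocks k \<tau> \<subseteq> kblocks k \<tau>'"
  proof
    fix D assume "D \<in> kblocks k \<tau>"
    then have D: "D \<in> \<tau>" "card D = k" by (auto simp: kblocks_def)
    then obtain B where B: "B \<in> \<tau>'" "D \<subseteq> B" using r unfolding refines_def by blast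
    then have "card D \<le> card B" using finite_block[OF assms(3)] by (simp add: card_mono)
    then have "card B = k" using D B assms(4) k2 unfolding ktype_def by auto
    then have "D = B" using D B finite_block[OF assms(3)] by (simp add: card_subset_eq)
    then show "D \<in> kblocks k \<tau>'" using B D by (simp add: kblocks_def)
  qed
next
  assume "kblocks k \<tau> \<subseteq> kblocks k \<tau>'"
  then show "refines A \<tau> \<tau>'"
    by (intro refines_ktypeI assms) (auto simp: kblocks_def)
qed

lemma card_Union_packing:
  assumes "packing F" shows "card (\<Union>F) = k * card F"
proof -
  have "card (\<Union>F) = (\<Sum>D\<in>F. card D)"
    using assms finite_A unfolding packing_def by (intro card_Union_disjoint) (auto intro: finite_subset)
  also have "\<dots> = (\<Sum>D\<in>F. k)" using assms unfolding packing_def by (intro sum.cong) auto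
  finally show ?thesis by simp
qed

text \<open>Only the number of k-blocks enters. Of the k-type partitions with a given number of
  k-blocks, either all have their type in \<open>\<Lambda>\<close> or none.\<close>

lemma partition_type_ktype:
  assumes "partition_on A \<tau>" "ktype k \<tau>"
  shows "partition_type \<tau> =
    replicate_mset (card (kblocks k \<tau>)) k + replicate_mset (card A - k * card (kblocks k \<tau>)) 1"
proof -
  let ?F = "kblocks k \<tau>" and ?S = "(\<lambda>a. {a}) ` (A - \<Union>(kblocks k \<tau>))"
  have F: "packing ?F" by (rule packing_kblocks[OF assms(1)])
  have disj: "?F \<inter> ?S = {}" unfolding kblocks_def using k2 by auto
  have "mset_set \<tau> = mset_set (?F \<union> ?S)" using ktype_decomp[OF assms] by simp
  also have "\<dots> = mset_set ?F + mset_set ?S"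
    using disj finite_packing[OF F] finite_A by (intro mset_set_Union) auto
  finally have "partition_type \<tau> = image_mset card (mset_set ?F) + image_mset card (mset_set ?S)"
    unfolding partition_type_def by simp
  moreover have "image_mset card (mset_set ?F) = image_mset (\<lambda>_. k) (mset_set ?F)"
    using finite_packing[OF F] by (intro image_mset_cong) (auto simp: kblocks_def)
  moreover have "image_mset card (mset_set ?S) = image_mset (\<lambda>_. 1) (mset_set ?S)"
    using finite_A by (intro image_mset_cong) auto
  moreover have "card ?S = card A - k * card ?F"
  proof -
    have "card ?S = card (A - \<Union>?F)" by (rule card_image) simp
    also have "\<dots> = card A - card (\<Union>?F)"
      using F finite_A unfolding packing_def by (intro card_Diff_subset) (auto intro: finite_subset)
    finally show ?thesis using card_Union_packing[OF F] by simp
  qed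
  ultimately show ?thesis by (simp add: image_mset_const_eq)
qed

section \<open>Packings inside the blocks of a fixed partition\<close>

context
  fixes x :: "nat set set"
  assumes x: "partition_on A x"
begin

lemma card_packing_split:
  assumes F: "packing F" and sub: "\<And>D. D \<in> F \<Longrightarrow> \<exists>B\<in>x. D \<subseteq> B"
  shows "card F = (\<Sum>B\<in>x. card {D \<in> F. D \<subseteq> B})"
proof -
  have "card (\<Union>B\<in>x. {D \<in> F. D \<subseteq> B}) = (\<Sum>B\<in>x. card {D \<in> F. D \<subseteq> B})"
  proof (rule card_UN_disjoint)
    show "finite x" by (rule finite_partition[OF x])
    show "\<forall>B\<in>x. finite {D \<in> F. D \<subseteq> B}" using finite_packing[OF F] by simp
    show "\<forall>B\<in>x. \<forall>B'\<in>x. B \<noteq> B' \<longrightarrow> {D \<in> F. D \<subseteq> B} \<inter> {D \<in> F. D \<subseteq> B'} = {}"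
    proof (intro ballI impI equals0I)
      fix B B' D assume *: "B \<in> x" "B' \<in> x" "B \<noteq> B'" "D \<in> {D \<in> F. D \<subseteq> B} \<inter> {D \<in> F. D \<subseteq> B'}"
      then have "card D = k" using F by (auto simp: packing_def)
      then obtain a where "a \<in> D" using k2 by fastforce
      then show False using * partition_on_block_unique[OF x] by blast
    qed
  qed
  moreover have "(\<Union>B\<in>x. {D \<in> F. D \<subseteq> B}) = F" using sub by auto
  ultimately show ?thesis by simp
qed

lemma packing_in_block:
  assumes F: "packing F" and B: "B \<in> x"
  shows "card (\<Union>{D \<in> F. D \<subseteq> B}) = k * card {D \<in> F. D \<subseteq> B}" "card {D \<in> F. D \<subseteq> B} \<le> card B div k"
proof -
  have "packing {D \<in> F. D \<subseteq> B}" using F unfolding packing_def by (auto intro: pairwise_subset)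
  then show *: "card (\<Union>{D \<in> F. D \<subseteq> B}) = k * card {D \<in> F. D \<subseteq> B}" by (rule card_Union_packing)
  have "card (\<Union>{D \<in> F. D \<subseteq> B}) \<le> card B" using finite_block[OF x B] by (intro card_mono) auto
  then show "card {D \<in> F. D \<subseteq> B} \<le> card B div k"
    unfolding * using k2 by (simp add: less_eq_div_iff_mult_less_eq mult.commute)
qed

lemma card_packing_le:
  assumes F: "packing F" and sub: "\<And>D. D \<in> F \<Longrightarrow> \<exists>B\<in>x. D \<subseteq> B"
  shows "card F \<le> max_kblocks k x"
proof -
  have "card F = (\<Sum>B\<in>x. card {D \<in> F. D \<subseteq> B})" by (rule card_packing_split[OF F]) (rule sub)
  also have "\<dots> \<le> max_kblocks k x" unfolding max_kblocks_def by (intro sum_mono packing_in_block(2)[OF F])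
  finally show ?thesis .
qed

text \<open>Equality of the totals forces equality in each of the blockwise bounds. This determines
  how the k-blocks of a full element are distributed.\<close>

lemma card_packing_eq_max:
  assumes F: "packing F" and sub: "\<And>D. D \<in> F \<Longrightarrow> \<exists>B\<in>x. D \<subseteq> B"
    and eq: "card F = max_kblocks k x" and B: "B \<in> x"
  shows "card {D \<in> F. D \<subseteq> B} = card B div k"
proof -
  have "(\<Sum>B\<in>x. card {D \<in> F. D \<subseteq> B}) = (\<Sum>B\<in>x. card B div k)"
    using card_packing_split[OF F sub] eq by (simp add: max_kblocks_def)
  then show ?thesis
    using sum_mono_inv[of "\<lambda>B. card {D \<in> F. D \<subseteq> B}" x "\<lambda>B. card B div k"] packing_in_block(2)[OF F]
      finite_partition[OF x] B by blast
qed

text \<open>Some block \<open>B\<close> contains fewer than \<open>card B div k\<close> members, so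
  at least \<open>k\<close> of its points are still uncovered.\<close>

lemma packing_extend_one:
  assumes F: "packing F" and sub: "\<And>D. D \<in> F \<Longrightarrow> \<exists>B\<in>x. D \<subseteq> B" and less: "card F < max_kblocks k x"
  shows "\<exists>D. D \<notin> F \<and> packing (insert D F) \<and> (\<exists>B\<in>x. D \<subseteq> B)"
proof -
  have "\<exists>B\<in>x. card {D \<in> F. D \<subseteq> B} < card B div k"
  proof (rule ccontr)
    assume "\<not> ?thesis"
    then have "max_kblocks k x \<le> (\<Sum>B\<in>x. card {D \<in> F. D \<subseteq> B})"
      unfolding max_kblocks_def by (intro sum_mono) (simp add: not_less)
    also have "\<dots> = card F" by (rule card_packing_split[OF F, symmetric]) (rule sub)
    finally show False using less by simp
  qed
  then obtain B where B: "B \<in> x" "card {D \<in> F. D \<subseteq> B} < card B div k" by blast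
  let ?U = "\<Union>{D \<in> F. D \<subseteq> B}"
  have finB: "finite B" by (rule finite_block[OF x B(1)])
  have "k * Suc (card {D \<in> F. D \<subseteq> B}) \<le> k * (card B div k)" using B(2) by (intro mult_le_mono2) simp
  also have "\<dots> \<le> card B" by (rule times_div_less_eq_dividend)
  finally have "k + card ?U \<le> card B" using packing_in_block(1)[OF F B(1)] by simp
  moreover have "card (B - ?U) = card B - card ?U"
    using finB by (intro card_Diff_subset) (auto intro: finite_subset)
  ultimately have "k \<le> card (B - ?U)" by simp
  then obtain D where D: "D \<subseteq> B - ?U" "card D = k" by (meson obtain_subset_with_card_n)
  have disj: "D \<inter> E = {}" if E: "E \<in> F" for E
  proof (cases "E \<subseteq> B")
    case True
    then show ?thesis using D E by auto
  next
    case False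
    then obtain B' where "B' \<in> x" "E \<subseteq> B'" "B' \<noteq> B" using sub[OF E] by auto
    then show ?thesis using D partition_on_block_unique[OF x B(1)] by blast
  qed
  have "D \<noteq> {}" using D k2 by auto
  then have "D \<notin> F" using disj by blast
  moreover have "packing (insert D F)"
    using F disj D B partition_onD1[OF x] unfolding packing_def disjoint_def by (auto simp: pairwise_insert disjnt_def)
  moreover have "D \<subseteq> B" using D by blast
  ultimately show ?thesis using B by blast
qed

lemma packing_extend:
  assumes "packing W" "\<And>D. D \<in> W \<Longrightarrow> \<exists>B\<in>x. D \<subseteq> B" "card W \<le> a" "a \<le> max_kblocks k x"
  shows "\<exists>F. packing F \<and> W \<subseteq> F \<and> (\<forall>D\<in>F. \<exists>B\<in>x. D \<subseteq> B) \<and> card F = a"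
  using assms(3,4)
proof (induction a rule: dec_induct)
  case base
  then show ?case using assms by blast
next
  case (step m)
  then obtain F where F: "packing F" "W \<subseteq> F" "\<And>D. D \<in> F \<Longrightarrow> \<exists>B\<in>x. D \<subseteq> B" "card F = m" by auto
  then obtain D where "D \<notin> F" "packing (insert D F)" "\<exists>B\<in>x. D \<subseteq> B"
    using packing_extend_one[OF F(1,3)] step by auto
  moreover have "card (insert D F) = Suc m" using F finite_packing \<open>D \<notin> F\<close> by simp
  ultimately show ?case using F by (intro exI[of _ "insert D F"]) auto
qed

text \<open>Division with remainder in every block. The right-hand side is the type of a k-type
  partition with \<open>max_kblocks k x\<close> blocks of size \<open>k\<close>, so
  \<open>gamma\<close> is realized by a maximal k-type refinement of \<open>x\<close>.\<close>

lemma gamma_eq: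
  "gamma k (partition_type x) =
    replicate_mset (max_kblocks k x) k + replicate_mset (card A - k * max_kblocks k x) 1"
proof -
  have fin: "finite x" by (rule finite_partition[OF x])
  have "card A = card (\<Union>x)" using x by (simp add: partition_on_def)
  also have "\<dots> = (\<Sum>B\<in>x. card B)"
    using x finite_block[OF x] by (intro card_Union_disjoint) (auto simp: partition_on_def)
  also have "\<dots> = (\<Sum>B\<in>x. k * (card B div k) + card B mod k)" by simp
  also have "\<dots> = k * max_kblocks k x + (\<Sum>B\<in>x. card B mod k)"
    unfolding max_kblocks_def sum_distrib_left by (rule sum.distrib)
  finally have "(\<Sum>B\<in>x. card B mod k) = card A - k * max_kblocks k x" by simp
  then show ?thesis
    unfolding gamma_def partition_type_def
    by (simp add: max_kblocks_def sum_unfold_sum_mset image_mset.compositionality comp_def)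
qed

text \<open>The singletons are the points outside the k-blocks; such points may be permuted
  freely.\<close>

lemma permute_fixes_ktype:
  assumes g: "g permutes A" and "ktype k x" and "\<And>D. D \<in> kblocks k x \<Longrightarrow> g ` D = D"
  shows "permute_partition g x = x"
proof (rule ktype_eqI)
  show "kblocks k (permute_partition g x) = kblocks k x"
    unfolding kblocks_permute[OF g] using assms(3) by (force simp: permute_partition_def image_iff)
qed (use assms x in \<open>auto simp: partition_on_permute[OF g] ktype_permute[OF g]\<close>)

text \<open>Inside each block of \<open>x\<close> there are equally many k-blocks on both sides,
  hence equally many singletons, and these can be matched up. \<open>W\<close> collects the k-blocks
  that must stay in place because a chain below uses them.\<close>

lemma ktype_conjugate_blockwise:
  assumes y: "partition_on A y" "ktype k y" "refines A y x"
    and y': "partition_on A y'" "ktype k y'" "refines A y' x"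
    and W: "W \<subseteq> kblocks k y" "W \<subseteq> kblocks k y'"
    and count: "\<And>B. B \<in> x \<Longrightarrow> card {D \<in> kblocks k y. D \<subseteq> B} = card {D \<in> kblocks k y'. D \<subseteq> B}"
  shows "\<exists>g. g permutes A \<and> (\<forall>B\<in>x. g ` B = B) \<and> permute_partition g y = y' \<and> (\<forall>D\<in>W. g ` D = D)"
proof -
  define blk where "blk D = {B \<in> x. D \<subseteq> B}" for D :: "nat set"
  \<comment> \<open>A label-preserving bijection fixes every member of \<open>W\<close>, and sends
    any other block to one of the same size within the same block of \<open>x\<close>.\<close>
  define lab :: "nat set \<Rightarrow> nat set + (nat set set \<times> nat)"
    where "lab D = (if D \<in> W then Inl D else Inr (blk D, card D))" for D
  have blk: "blk D = {B} \<longleftrightarrow> D \<subseteq> B" if "partition_on A z" "D \<in> z" "B \<in> x" for z D B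
  proof -
    have "D \<noteq> {}" using that partition_onD3 by blast
    then show ?thesis unfolding blk_def using that partition_on_block_unique[OF x] by blast
  qed
  have blk_ex: "\<exists>B\<in>x. blk D = {B} \<and> D \<subseteq> B" if "partition_on A z" "refines A z x" "D \<in> z" for z D
  proof -
    have "\<exists>B\<in>x. D \<subseteq> B" using that unfolding refines_def by blast
    then show ?thesis using blk[OF that(1,3)] by blast
  qed
  have singles: "card {D \<in> z. D \<subseteq> B \<and> card D = 1} = card B - k * card {D \<in> kblocks k z. D \<subseteq> B}"
    if z: "partition_on A z" "ktype k z" "refines A z x" and B: "B \<in> x" for z B
  proof -
    let ?U = "\<Union>{D \<in> kblocks k z. D \<subseteq> B}"
    have "{D \<in> z. D \<subseteq> B \<and> card D = 1} = (\<lambda>a. {a}) ` (B - ?U)"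
    proof (intro equalityI subsetI)
      fix D assume D: "D \<in> {D \<in> z. D \<subseteq> B \<and> card D = 1}"
      then obtain a where a: "D = {a}" using card_1_singletonE[of D] by auto
      have "a \<notin> ?U"
      proof
        assume "a \<in> ?U"
        then obtain E where E: "E \<in> z" "card E = k" "a \<in> E" by (auto simp: kblocks_def)
        then have "E = D" using partition_on_block_unique[OF z(1), of E D a] D a by auto
        then show False using D E k2 by auto
      qed
      then show "D \<in> (\<lambda>a. {a}) ` (B - ?U)" using D a by auto
    next
      fix D assume "D \<in> (\<lambda>a. {a}) ` (B - ?U)"
      then obtain a where a: "D = {a}" "a \<in> B" "a \<notin> ?U" by auto
      then have "a \<in> A" using B partition_onD1[OF x] by auto
      \<comment> \<open>As \<open>z\<close> refines \<open>x\<close>, a k-block through a point of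
        \<open>B\<close> lies entirely in \<open>B\<close> and so is already counted in
        \<open>?U\<close>.\<close>
      moreover have "a \<notin> E" if E: "E \<in> kblocks k z" for E
      proof
        assume "a \<in> E"
        have "E \<in> z" using E by (simp add: kblocks_def)
        then obtain B' where "B' \<in> x" "E \<subseteq> B'" using z(3) unfolding refines_def by blast
        then have "E \<subseteq> B" using partition_on_block_unique[OF x B] a \<open>a \<in> E\<close> by blast
        then show False using a \<open>a \<in> E\<close> E by blast
      qed
      ultimately have "D \<in> z" using ktype_decomp[OF z(1,2)] a by blast
      then show "D \<in> {D \<in> z. D \<subseteq> B \<and> card D = 1}" using a by simp
    qed
    then have "card {D \<in> z. D \<subseteq> B \<and> card D = 1} = card (B - ?U)" by (simp add: card_image)
    also have "\<dots> = card B - card ?U"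
      using finite_block[OF x B] by (intro card_Diff_subset) (auto intro: finite_subset)
    finally show ?thesis using packing_in_block(1)[OF packing_kblocks[OF z(1)] B] by simp
  qed
  have Wz: "D \<in> z \<and> card D = k" if "W \<subseteq> kblocks k z" "D \<in> W" for z D
    using that by (auto simp: kblocks_def)
  \<comment> \<open>What matters is that the formula depends on \<open>z\<close> only through the
    numbers of k-blocks inside the blocks of \<open>x\<close>, which \<open>count\<close> equates
    for \<open>y\<close> and \<open>y'\<close>.\<close>
  have fibre: "card {D \<in> z. lab D = l} = (case l of Inl D \<Rightarrow> (if D \<in> W then 1 else 0)
      | Inr (S, c) \<Rightarrow> (if \<exists>B\<in>x. S = {B} then
            (if c = k then card {D \<in> kblocks k z. D \<subseteq> the_elem S} - card {D \<in> W. D \<subseteq> the_elem S}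
             else if c = 1 then card (the_elem S) - k * card {D \<in> kblocks k z. D \<subseteq> the_elem S} else 0)
          else 0))"
    if z: "partition_on A z" "ktype k z" "refines A z x" "W \<subseteq> kblocks k z" for z l
  proof (cases l)
    case (Inl D0)
    then have "{D \<in> z. lab D = l} = (if D0 \<in> W then {D0} else {})"
      using Wz[OF z(4)] unfolding lab_def by auto
    then show ?thesis using Inl by simp
  next
    case (Inr p)
    obtain S c where l: "l = Inr (S, c)" using Inr by (cases p) auto
    show ?thesis
    proof (cases "\<exists>B\<in>x. S = {B}")
      case False
      have "lab D \<noteq> l" if "D \<in> z" for D
        using blk_ex[OF z(1,3) that] False unfolding lab_def l by auto
      then have "{D \<in> z. lab D = l} = {}" by blast
      then show ?thesis using False l by (simp del: Collect_empty_eq)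
    next
      case True
      then obtain B where B: "B \<in> x" "S = {B}" by blast
      have eq: "{D \<in> z. lab D = l} = {D \<in> z. D \<notin> W \<and> D \<subseteq> B \<and> card D = c}"
        using blk[OF z(1) _ B(1)] unfolding lab_def l B(2) by auto
      consider "c = k" | "c = 1" | "c \<noteq> k" "c \<noteq> 1" by blast
      then show ?thesis
      proof cases
        case 1
        have "{D \<in> z. lab D = l} = {D \<in> kblocks k z. D \<subseteq> B} - {D \<in> W. D \<subseteq> B}"
          unfolding eq 1 by (auto simp: kblocks_def)
        moreover have "card \<dots> = card {D \<in> kblocks k z. D \<subseteq> B} - card {D \<in> W. D \<subseteq> B}"
          using z(4) finite_packing[OF packing_kblocks[OF z(1)]]
          by (intro card_Diff_subset) (auto intro: finite_subset)
        ultimately show ?thesis using 1 l B by simp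
      next
        case 2
        have "{D \<in> z. lab D = l} = {D \<in> z. D \<subseteq> B \<and> card D = 1}"
          unfolding eq 2 using Wz[OF z(4)] k2 by auto
        then show ?thesis using singles[OF z(1,2,3) B(1)] 2 l B k2 by simp
      next
        case 3
        have "{D \<in> z. lab D = l} = {}"
          unfolding eq using 3 z(2) by (auto simp: ktype_def)
        then show ?thesis using 3 l B by (simp del: Collect_empty_eq)
      qed
    qed
  qed
  have "card {D \<in> y. lab D = l} = card {D \<in> y'. lab D = l}" for l
    unfolding fibre[OF y W(1)] fibre[OF y' W(2)] using count by (auto split: sum.split)
  then obtain \<phi> where \<phi>: "bij_betw \<phi> y y'" "\<And>D. D \<in> y \<Longrightarrow> lab (\<phi> D) = lab D"
    using labelled_bij_betw_exists[of y y' lab lab] finite_partition y(1) y'(1) by blast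
  have \<phi>_W: "\<phi> D = D" if "D \<in> W" "D \<in> y" for D
    using \<phi>(2)[OF that(2)] that(1) unfolding lab_def by (auto split: if_splits)
  have \<phi>_lab: "blk (\<phi> D) = blk D" "card (\<phi> D) = card D" if "D \<in> y" for D
    using \<phi>(2)[OF that] unfolding lab_def by (auto split: if_splits)
  obtain g where g: "g permutes A" "\<And>D. D \<in> y \<Longrightarrow> g ` D = \<phi> D"
    using permutation_lifting_block_bij[OF finite_A y(1) y'(1) \<phi>(1) \<phi>_lab(2)] by auto
  have "g ` B = B" if B: "B \<in> x" for B
  proof (rule card_subset_eq)
    show "finite B" by (rule finite_block[OF x B])
    show "card (g ` B) = card B" by (rule card_image_permutes[OF g(1)])
    show "g ` B \<subseteq> B"
    proof
      fix b assume "b \<in> g ` B"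
      then obtain a where a: "a \<in> B" "b = g a" by blast
      then obtain D where D: "D \<in> y" "a \<in> D" using B partition_onD1[OF x] partition_onD1[OF y(1)] by blast
      obtain B' where B': "B' \<in> x" "blk D = {B'}" "D \<subseteq> B'" using blk_ex[OF y(1,3) D(1)] by blast
      then have "B' = B" using partition_on_block_unique[OF x B] a D by blast
      then have "\<phi> D \<subseteq> B" using \<phi>_lab(1)[OF D(1)] B' unfolding blk_def by blast
      then show "b \<in> B" using g(2)[OF D(1)] a D by blast
    qed
  qed
  moreover have "permute_partition g y = y'"
    unfolding permute_partition_def using g(2) bij_betw_imp_surj_on[OF \<phi>(1)] by simp
  moreover have "g ` D = D" if "D \<in> W" for D
    using that W(1) g(2)[of D] \<phi>_W[of D] by (auto simp: kblocks_def)
  ultimately show ?thesis using g(1) by blast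
qed

text \<open>When \<open>x\<close> is of k-type, \<open>y\<close> and \<open>y'\<close> may select
  different k-blocks of \<open>x\<close>, so the blocks of \<open>x\<close> cannot all be preserved.
  Permuting them is enough, and only the number selected has to agree.\<close>

lemma ktype_conjugate_in_ktype:
  assumes ktx: "ktype k x"
    and y: "partition_on A y" "ktype k y" "kblocks k y \<subseteq> kblocks k x"
    and y': "partition_on A y'" "ktype k y'" "kblocks k y' \<subseteq> kblocks k x"
    and W: "W \<subseteq> kblocks k y" "W \<subseteq> kblocks k y'"
    and count: "card (kblocks k y) = card (kblocks k y')"
  shows "\<exists>g. g permutes A \<and> permute_partition g x = x \<and> permute_partition g y = y' \<and> (\<forall>D\<in>W. g ` D = D)"
proof -
  let ?F = "kblocks k y" and ?F' = "kblocks k y'"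
  \<comment> \<open>Singletons and members of \<open>W\<close> are to be fixed; for the other
    k-blocks of \<open>x\<close> the label records whether they are selected. The source is labelled
    by \<open>?F\<close> and the target by \<open>?F'\<close>, so selected blocks go to selected
    blocks.\<close>
  define lab :: "nat set set \<Rightarrow> nat set \<Rightarrow> nat set + bool"
    where "lab F D = (if D \<in> W \<or> card D \<noteq> k then Inl D else Inr (D \<in> F))" for F D
  have finx: "finite x" by (rule finite_partition[OF x])
  have "W \<subseteq> x" using W y(3) by (auto simp: kblocks_def)
  have fibre: "card {D \<in> x. lab F D = l} = (case l of Inl D \<Rightarrow> (if D \<in> x \<and> (D \<in> W \<or> card D \<noteq> k) then 1 else 0)
      | Inr b \<Rightarrow> (if b then card F - card W else card (kblocks k x) - card F))"
    if F: "F \<subseteq> kblocks k x" "W \<subseteq> F" for F l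
  proof (cases l)
    case (Inl D0)
    then have "{D \<in> x. lab F D = l} = (if D0 \<in> x \<and> (D0 \<in> W \<or> card D0 \<noteq> k) then {D0} else {})"
      unfolding lab_def by auto
    then show ?thesis using Inl by simp
  next
    case (Inr b)
    have fin: "finite (kblocks k x)" using finx by (simp add: kblocks_def)
    have "{D \<in> x. lab F D = l} = (if b then F - W else kblocks k x - F)"
      using F unfolding lab_def Inr kblocks_def by auto
    moreover have "card (F - W) = card F - card W" "card (kblocks k x - F) = card (kblocks k x) - card F"
      using F fin by (auto intro!: card_Diff_subset intro: finite_subset)
    ultimately show ?thesis using Inr by simp
  qed
  have "card {D \<in> x. lab ?F D = l} = card {D \<in> x. lab ?F' D = l}" for l
    unfolding fibre[OF y(3) W(1)] fibre[OF y'(3) W(2)] using count by (auto split: sum.split)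
  then obtain \<phi> where \<phi>: "bij_betw \<phi> x x" "\<And>D. D \<in> x \<Longrightarrow> lab ?F' (\<phi> D) = lab ?F D"
    using labelled_bij_betw_exists[of x x "lab ?F" "lab ?F'"] finx by blast
  have \<phi>_W: "\<phi> D = D" if "D \<in> x" "D \<in> W \<or> card D \<noteq> k" for D
    using \<phi>(2)[OF that(1)] that(2) unfolding lab_def by (auto split: if_splits)
  have card_\<phi>: "card (\<phi> D) = card D" if "D \<in> x" for D
    using \<phi>(2)[OF that] unfolding lab_def by (auto split: if_splits)
  obtain g where g: "g permutes A" "\<And>D. D \<in> x \<Longrightarrow> g ` D = \<phi> D"
    using permutation_lifting_block_bij[OF finite_A x x \<phi>(1) card_\<phi>] by auto
  have W_fixed: "g ` D = D" if "D \<in> W" for D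
    using that \<open>W \<subseteq> x\<close> g(2)[of D] \<phi>_W[of D] by auto
  have "permute_partition g x = x"
    unfolding permute_partition_def using g(2) bij_betw_imp_surj_on[OF \<phi>(1)] by simp
  moreover have "permute_partition g y = y'"
  proof (rule ktype_eqI)
    have "permute_partition g ?F \<subseteq> ?F'"
    proof
      fix E assume "E \<in> permute_partition g ?F"
      then obtain D where D: "D \<in> ?F" "E = g ` D" unfolding permute_partition_def by blast
      then have Dx: "D \<in> x" "card D = k" using y(3) by (auto simp: kblocks_def)
      show "E \<in> ?F'"
      proof (cases "D \<in> W")
        case True
        then show ?thesis using W_fixed W D by auto
      next
        case False
        then have "lab ?F' (\<phi> D) = Inr True" using \<phi>(2)[OF Dx(1)] D Dx unfolding lab_def by auto
        then show ?thesis using D g(2)[OF Dx(1)] unfolding lab_def by (auto split: if_splits)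
      qed
    qed
    moreover have "card (permute_partition g ?F) = card ?F" by (rule card_permute[OF g(1)])
    moreover have "finite ?F'" by (rule finite_packing[OF packing_kblocks[OF y'(1)]])
    ultimately show "kblocks k (permute_partition g y) = ?F'"
      using count by (simp add: kblocks_permute[OF g(1)] card_subset_eq)
  qed (use y y' in \<open>auto simp: partition_on_permute[OF g(1)] ktype_permute[OF g(1)]\<close>)
  ultimately show ?thesis using g(1) W_fixed by blast
qed

end

end

section \<open>The interval below a set partition\<close>

text \<open>Otherwise the simplifier turns \<open>{1..n}\<close> into \<open>{Suc 0..n}\<close>, and facts about the former no longer apply.\<close>

declare One_nat_def [simp del]

section \<open>The stabilizer as a group and an invariant rank\<close>

lemma carrier_Stab: "carrier (Stab n \<pi>) = {g. g permutes {1..n} \<and> permute_partition g \<pi> = \<pi>}"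
  by (auto simp: Stab_def stabilizer_def sym_group_def)

lemma permute_partition_id: "permute_partition id \<tau> = \<tau>"
  by (simp add: permute_partition_def)

lemma permute_partition_comp: "permute_partition (g \<circ> h) \<tau> = permute_partition g (permute_partition h \<tau>)"
  by (simp add: permute_partition_def image_comp comp_def)

lemma inj_permute_partition:
  assumes "g permutes A" shows "inj (permute_partition g)"
  unfolding permute_partition_def using inj_image_permutes[OF assms] by (intro injI) (simp add: inj_image_eq_iff)

lemma group_Stab: "group (Stab n \<pi>)"
  unfolding Stab_def
proof (rule group.subgroup_imp_group[OF sym_group_is_group], rule group.subgroupI[OF sym_group_is_group])
  let ?H = "stabilizer (sym_group n) permute_partition \<pi>"
  show "?H \<subseteq> carrier (sym_group n)" by (auto simp: stabilizer_def)
  show "?H \<noteq> {}" 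
  proof -
    have "id \<in> ?H" using permute_partition_id permutes_id by (simp add: stabilizer_def sym_group_def)
    then show ?thesis by blast
  qed
  show "inv\<^bsub>sym_group n\<^esub> g \<in> ?H" if "g \<in> ?H" for g
  proof -
    have g: "g permutes {1..n}" "permute_partition g \<pi> = \<pi>" using that by (auto simp: stabilizer_def sym_group_def)
    have "permute_partition (Hilbert_Choice.inv g) \<pi> = permute_partition (Hilbert_Choice.inv g \<circ> g) \<pi>"
      using g(2) by (simp add: permute_partition_comp)
    also have "\<dots> = \<pi>" using permutes_inv_o(2)[OF g(1)] by (simp add: permute_partition_id)
    finally show ?thesis
      using that g by (simp add: stabilizer_def sym_group_carrier sym_group_inv_equality permutes_inv)
  qed
  show "g \<otimes>\<^bsub>sym_group n\<^esub> h \<in> ?H" if "g \<in> ?H" "h \<in> ?H" for g h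
    using that by (auto simp: stabilizer_def sym_group_def permutes_compose permute_partition_comp)
qed

text \<open>The size of the equivalence relation belonging to the partition. Refinement is inclusion
  of these relations, which makes the rank strictly increasing.\<close>

definition pair_rank :: "nat set set \<Rightarrow> nat" where
  "pair_rank \<tau> = card (\<Union>B\<in>\<tau>. B \<times> B)"

lemma pair_rank_permute:
  assumes "g permutes A" shows "pair_rank (permute_partition g \<tau>) = pair_rank \<tau>"
proof -
  have "(\<Union>B\<in>permute_partition g \<tau>. B \<times> B) = map_prod g g ` (\<Union>B\<in>\<tau>. B \<times> B)"
    unfolding permute_partition_def by auto
  moreover have "inj (map_prod g g)" using assms by (simp add: permutes_inj prod.inj_map)
  ultimately show ?thesis unfolding pair_rank_def by (simp add: card_image inj_on_subset)
qed

lemma pair_rank_less: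
  assumes "finite A" "refines A \<tau> x" "\<tau> \<noteq> x"
  shows "pair_rank \<tau> < pair_rank x"
  unfolding pair_rank_def
proof (rule psubset_card_mono)
  have \<tau>: "partition_on A \<tau>" and x: "partition_on A x" using assms(2) by (auto simp: refines_def)
  show "finite (\<Union>B\<in>x. B \<times> B)"
    by (rule finite_subset[of _ "A \<times> A"]) (use x assms(1) in \<open>auto simp: partition_on_def\<close>)
  have "(\<Union>B\<in>\<tau>. B \<times> B) \<subseteq> (\<Union>B\<in>x. B \<times> B)"
    using assms(2) unfolding refines_def by fast
  moreover have "(\<Union>B\<in>\<tau>. B \<times> B) \<noteq> (\<Union>B\<in>x. B \<times> B)"
  proof
    assume eq: "(\<Union>B\<in>\<tau>. B \<times> B) = (\<Union>B\<in>x. B \<times> B)"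
    \<comment> \<open>Equal relations would make \<open>x\<close> refine \<open>\<tau>\<close> too,
      contradicting antisymmetry.\<close>
    have "\<exists>D\<in>\<tau>. C \<subseteq> D" if C: "C \<in> x" for C
    proof -
      have "C \<noteq> {}" using C partition_onD3[OF x] by metis
      then obtain a where a: "a \<in> C" by blast
      then obtain D where D: "D \<in> \<tau>" "a \<in> D" using C partition_onD1[OF x] partition_onD1[OF \<tau>] by auto
      have "b \<in> D" if "b \<in> C" for b
      proof -
        have "(a, b) \<in> (\<Union>B\<in>\<tau>. B \<times> B)" unfolding eq using that a C by auto
        then obtain D' where "D' \<in> \<tau>" "a \<in> D'" "b \<in> D'" by auto
        then show ?thesis using partition_on_block_unique[OF \<tau>] D by blast
      qed
      then show ?thesis using D by blast
    qed
    then have "refines A x \<tau>" using x \<tau> by (auto simp: refines_def)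
    then show False using refines_asym assms by metis
  qed
  ultimately show "(\<Union>B\<in>\<tau>. B \<times> B) \<subset> (\<Union>B\<in>x. B \<times> B)" by blast
qed

text \<open>Every block of \<open>z\<close> is a union of blocks of \<open>x\<close>. This keeps the
  part of a chain above the pivot fixed.\<close>

lemma permute_fixes_coarser:
  assumes g: "g permutes A" and r: "refines A x z" and fix_blocks: "\<And>B. B \<in> x \<Longrightarrow> g ` B = B"
    and fin: "finite A"
  shows "permute_partition g z = z"
proof -
  have x: "partition_on A x" and z: "partition_on A z" using r by (auto simp: refines_def)
  have "g ` C = C" if C: "C \<in> z" for C
  proof (rule card_subset_eq)
    show "finite C" using C z fin unfolding partition_on_def by (auto intro: finite_subset)
    show "card (g ` C) = card C" by (rule card_image_permutes[OF g])
    show "g ` C \<subseteq> C"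
    proof
      fix b assume "b \<in> g ` C"
      then obtain a where a: "a \<in> C" "b = g a" by blast
      then obtain B where B: "B \<in> x" "a \<in> B" using C partition_onD1[OF x] partition_onD1[OF z] by blast
      obtain C' where "C' \<in> z" "B \<subseteq> C'" using r B unfolding refines_def by blast
      then have "B \<subseteq> C" using partition_on_block_unique[OF z C] a B by blast
      then show "b \<in> C" using fix_blocks[OF B(1)] a B by blast
    qed
  qed
  then show ?thesis unfolding permute_partition_def by simp
qed

locale partition_interval = k_partitions "{1..n}" k for n k :: nat +
  fixes \<Lambda> :: "nat multiset set" and \<pi> :: "nat set set"
  assumes one_notin: "replicate_mset n 1 \<notin> \<Lambda>"
    and cond_C: "condition_C k \<Lambda>"
    and part_\<pi>: "partition_on {1..n} \<pi>"
    and type_\<pi>: "partition_type \<pi> \<in> \<Lambda> \<union> {{#n#}}"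
    and I_nonempty: "open_interval n \<Lambda> \<pi> \<noteq> {}"
begin

abbreviation A :: "nat set" where "A \<equiv> {1..n}"

abbreviation I :: "nat set set set" where "I \<equiv> open_interval n \<Lambda> \<pi>"

abbreviation le :: "nat set set \<Rightarrow> nat set set \<Rightarrow> bool" where "le \<equiv> refines A"

lemma part_bottom: "partition_on A (bottom_partition n)"
  unfolding bottom_partition_def by (rule partition_on_singletons)

lemma type_bottom: "partition_type (bottom_partition n) = replicate_mset n 1"
proof -
  have "partition_type (bottom_partition n) = image_mset (\<lambda>_. 1) (mset_set (bottom_partition n))"
    unfolding partition_type_def
    by (intro image_mset_cong) (auto simp: bottom_partition_def)
  moreover have "card (bottom_partition n) = n"
    unfolding bottom_partition_def by (subst card_image) auto
  ultimately show ?thesis by (simp add: image_mset_const_eq)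
qed

text \<open>The bottom partition has type (1^n), so membership in \<open>\<Lambda>\<close> already
  excludes it.\<close>

lemma I_iff: "\<tau> \<in> I \<longleftrightarrow> partition_type \<tau> \<in> \<Lambda> \<and> le \<tau> \<pi> \<and> \<tau> \<noteq> \<pi>"
proof -
  have "le (bottom_partition n) \<tau>" if "partition_on A \<tau>"
    unfolding refines_def using part_bottom that partition_onD1[OF that] by (auto simp: bottom_partition_def)
  then show ?thesis
    unfolding open_interval_def using type_bottom one_notin by (auto simp: refines_def)
qed

lemma I_part: "\<tau> \<in> I \<Longrightarrow> partition_on A \<tau>"
  by (auto simp: I_iff refines_def)

lemma le_part: "le a b \<Longrightarrow> partition_on A a" "le a b \<Longrightarrow> partition_on A b"
  by (auto simp: refines_def)

end

sublocale partition_interval \<subseteq>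
  ranked_poset_action "Stab n \<pi>" permute_partition "open_interval n \<Lambda> \<pi>" "refines {1..n}" pair_rank
proof (intro ranked_poset_action.intro ranked_poset_action_axioms.intro)
  show "group (Stab n \<pi>)" by (rule group_Stab)
  show "finite (carrier (Stab n \<pi>))"
    unfolding carrier_Stab by (rule finite_subset[OF _ finite_permutations[OF finite_A]]) auto
  show "permute_partition \<one>\<^bsub>Stab n \<pi>\<^esub> x = x" for x
    by (simp add: Stab_def sym_group_def permute_partition_def)
  show "permute_partition (g \<otimes>\<^bsub>Stab n \<pi>\<^esub> h) x = permute_partition g (permute_partition h x)" for g h x
    by (simp add: Stab_def sym_group_def permute_partition_comp)
  show "finite I"
    by (rule finite_subset[OF _ finitely_many_partition_on[OF finite_A]]) (auto simp: open_interval_def)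
  show "permute_partition g x \<in> I" if "g \<in> carrier (Stab n \<pi>)" "x \<in> I" for g x
  proof -
    have g: "g permutes A" "permute_partition g \<pi> = \<pi>" using that by (auto simp: carrier_Stab)
    have "permute_partition g x \<noteq> \<pi>"
      using that(2) injD[OF inj_permute_partition[OF g(1)], of x \<pi>] g(2) by (auto simp: I_iff)
    then show ?thesis using that(2) refines_permute[OF g(1), of x \<pi>] partition_type_permute[OF g(1)] g(2)
      by (simp add: I_iff)
  qed
  show "refines A x x" if "x \<in> I" for x by (rule refines_refl[OF I_part[OF that]])
  show "refines A (permute_partition g x) (permute_partition g y)"
    if "g \<in> carrier (Stab n \<pi>)" "refines A x y" for g x y
    using that refines_permute by (auto simp: carrier_Stab)
  show "pair_rank (permute_partition g x) = pair_rank x" if "g \<in> carrier (Stab n \<pi>)" for g x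
    using that pair_rank_permute by (auto simp: carrier_Stab)
  show "pair_rank x < pair_rank y" if "refines A x y" "x \<noteq> y" for x y
    by (rule pair_rank_less[OF finite_A that])
qed

section \<open>Pivots, full elements and the toggle\<close>

context partition_interval
begin

abbreviation act :: "(nat \<Rightarrow> nat) \<Rightarrow> nat set set \<Rightarrow> nat set set" where "act \<equiv> permute_partition"

abbreviation kt :: "nat set set \<Rightarrow> bool" where "kt \<equiv> ktype k"

definition nb :: "nat set set \<Rightarrow> nat" where "nb \<tau> = card (kblocks k \<tau>)"

text \<open>Maximality is among the elements of the interval only: for \<open>x = \<pi>\<close> the
  number can be smaller than \<open>max_kblocks k \<pi>\<close>, since larger k-types may be missing
  from \<open>\<Lambda>\<close>.\<close>

definition full :: "nat set set \<Rightarrow> nat set set \<Rightarrow> bool" where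
  "full y x \<longleftrightarrow> y \<in> I \<and> kt y \<and> le y x \<and> y \<noteq> x \<and> (\<forall>z\<in>I. kt z \<and> le z x \<and> z \<noteq> x \<longrightarrow> nb z \<le> nb y)"

definition pivot :: "nat set set set \<Rightarrow> nat set set \<Rightarrow> bool" where
  "pivot c x \<longleftrightarrow> (x \<in> c \<and> \<not> kt x \<and> (\<forall>z\<in>c. \<not> kt z \<longrightarrow> le x z)) \<or> (x = \<pi> \<and> (\<forall>z\<in>c. kt z))"

definition pv :: "nat set set set \<Rightarrow> nat set set" where "pv c = (THE x. pivot c x)"

text \<open>At most one element, by \<open>full_unique\<close>. Using a set makes
  \<open>drop_full\<close> total and visibly equivariant.\<close>

definition fulls :: "nat set set set \<Rightarrow> nat set set set" where "fulls c = {y \<in> c. full y (pv c)}"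

definition upper :: "nat set set set \<Rightarrow> nat set set set" where "upper c = {z \<in> c. le (pv c) z}"

definition drop_full :: "nat set set set \<Rightarrow> nat set set set" where "drop_full c = c - fulls c"

text \<open>The factor exceeds every possible value of \<open>card (drop_full c)\<close>, so the
  first count dominates and the order is lexicographic.\<close>

definition key :: "nat set set set \<Rightarrow> nat" where
  "key c = Suc (card I) * card (upper c) + card (drop_full c)"

definition toggled :: "nat set set set set" where "toggled = {c \<in> \<Delta>. fulls c \<noteq> {}}"

lemma \<Delta>_I: "c \<in> \<Delta> \<Longrightarrow> z \<in> c \<Longrightarrow> z \<in> I"
  using \<Delta>D(2) by blast

lemma le_\<pi>: "z \<in> I \<Longrightarrow> le z \<pi>"
  by (simp add: I_iff)

lemma \<pi>_notin_I: "\<pi> \<notin> I"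
  by (simp add: I_iff)

lemma chain_least:
  assumes "c \<in> \<Delta>" "S \<subseteq> c" "S \<noteq> {}"
  shows "\<exists>x\<in>S. \<forall>z\<in>S. le x z"
proof -
  have "finite S" using assms \<Delta>D(1) finite_subset by metis
  then obtain x where x: "is_arg_min pair_rank (\<lambda>z. z \<in> S) x"
    using ex_is_arg_min_if_finite[OF _ assms(3)] by blast
  have "le x z" if "z \<in> S" for z
  proof (rule ccontr)
    assume "\<not> le x z"
    then have "le z x" "z \<noteq> x"
      using \<Delta>D(3)[OF assms(1), of x z] x that assms(2) refines_refl I_part \<Delta>_I[OF assms(1)]
      unfolding is_arg_min_def by blast+
    then show False using pair_rank_less[OF finite_A] x that unfolding is_arg_min_def by blast
  qed
  then show ?thesis using x unfolding is_arg_min_def by blast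
qed

lemma chain_greatest:
  assumes "c \<in> \<Delta>" "S \<subseteq> c" "S \<noteq> {}"
  shows "\<exists>x\<in>S. \<forall>z\<in>S. le z x"
proof -
  have "finite S" using assms \<Delta>D(1) finite_subset by metis
  then obtain x where x: "x \<in> S" "\<And>z. z \<in> S \<Longrightarrow> pair_rank z \<le> pair_rank x"
    using Max_in[of "pair_rank ` S"] Max_ge[of "pair_rank ` S"] assms(3) by fastforce
  have "le z x" if "z \<in> S" for z
  proof (rule ccontr)
    assume "\<not> le z x"
    then have "le x z" "z \<noteq> x"
      using \<Delta>D(3)[OF assms(1), of x z] x that assms(2) refines_refl I_part \<Delta>_I[OF assms(1)] by blast+
    then show False using pair_rank_less[OF finite_A] x(2)[OF that] by (metis leD)
  qed
  then show ?thesis using x by blast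
qed

lemma pivot_unique:
  assumes "c \<in> \<Delta>" "pivot c x" "pivot c y" shows "x = y"
  using assms refines_asym unfolding pivot_def by metis

lemma pivot_pv:
  assumes "c \<in> \<Delta>" shows "pivot c (pv c)"
proof -
  have "\<exists>x. pivot c x"
  proof (cases "\<forall>z\<in>c. kt z")
    case True
    then show ?thesis unfolding pivot_def by blast
  next
    case False
    then show ?thesis using chain_least[OF assms, of "{z \<in> c. \<not> kt z}"] unfolding pivot_def by auto
  qed
  then show ?thesis unfolding pv_def using pivot_unique[OF assms] by (metis theI')
qed

lemma pv_eqI: "c \<in> \<Delta> \<Longrightarrow> pivot c x \<Longrightarrow> pv c = x"
  using pivot_unique pivot_pv by blast

lemma pv_cases:
  assumes "c \<in> \<Delta>"
  obtains "pv c \<in> I" "\<not> kt (pv c)" "pv c \<in> c" | "pv c = \<pi>" "\<forall>z\<in>c. kt z"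
  using pivot_pv[OF assms] \<Delta>_I[OF assms] unfolding pivot_def by blast

lemma pv_le_\<pi>: "c \<in> \<Delta> \<Longrightarrow> le (pv c) \<pi>"
  by (erule pv_cases) (auto simp: le_\<pi> refines_refl part_\<pi>)

lemma below_pv:
  assumes "c \<in> \<Delta>" "z \<in> c" "\<not> le (pv c) z"
  shows "kt z" "le z (pv c)" "z \<noteq> pv c"
proof -
  show "kt z" using pivot_pv[OF assms(1)] assms unfolding pivot_def by blast
  show "z \<noteq> pv c" using assms refines_refl I_part \<Delta>_I by blast
  show "le z (pv c)" using assms(1)
  proof (cases rule: pv_cases)
    case 1
    then show ?thesis using \<Delta>D(3) assms by blast
  next
    case 2
    then show ?thesis using le_\<pi> \<Delta>_I assms by simp
  qed
qed

lemma kt_le_eq: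
  assumes "partition_on A y" "kt y" "partition_on A y'" "kt y'" "le y y'" "nb y' \<le> nb y"
  shows "y = y'"
proof (rule ktype_eqI[OF assms(1-4)])
  have "kblocks k y \<subseteq> kblocks k y'" using assms refines_ktype_iff by blast
  then show "kblocks k y = kblocks k y'"
    using assms(6) card_seteq finite_packing packing_kblocks[OF assms(3)] unfolding nb_def by blast
qed

text \<open>A k-type element above \<open>y\<close> has at least as many k-blocks, so by maximality
  it equals \<open>y\<close>. In a chain a full element is therefore the largest one of k-type
  strictly below \<open>x\<close>.\<close>

lemma kt_below_full:
  assumes "c \<in> \<Delta>" "y \<in> c" "z \<in> c" "full y x" "kt z" "le z x" "z \<noteq> x"
  shows "le z y"
proof -
  have I: "y \<in> I" "z \<in> I" using assms \<Delta>_I by auto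
  have "y = z" if "le y z"
    using kt_le_eq[OF I_part[OF I(1)] _ I_part[OF I(2)]] assms that I unfolding full_def by blast
  then show ?thesis using \<Delta>D(3)[OF assms(1-3)] by blast
qed

lemma full_unique:
  assumes "c \<in> \<Delta>" "y \<in> c" "z \<in> c" "full y x" "full z x" shows "y = z"
proof -
  have "le z y" "le y z" using kt_below_full assms unfolding full_def by blast+
  then show ?thesis using refines_asym by blast
qed

section \<open>Existence of full elements\<close>

lemma kt_type:
  assumes "partition_on A y" "kt y"
  shows "partition_type y = replicate_mset (nb y) k + replicate_mset (n - k * nb y) 1"
  using partition_type_ktype[OF assms] by (simp add: nb_def)

lemma nb_le_max:
  assumes "le y x" shows "nb y \<le> max_kblocks k x"
  unfolding nb_def
proof (rule card_packing_le[OF le_part(2)[OF assms] packing_kblocks[OF le_part(1)[OF assms]]])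
  show "\<exists>B\<in>x. D \<subseteq> B" if "D \<in> kblocks k y" for D
    using that assms by (auto simp: kblocks_def refines_def)
qed

lemma extend_kt:
  assumes w: "kt w" "le w x" and a: "nb w \<le> a" "a \<le> max_kblocks k x"
  obtains y where "kt y" "le w y" "le y x" "nb y = a"
proof -
  have x: "partition_on A x" and wp: "partition_on A w" using w by (auto dest: le_part)
  have "\<exists>B\<in>x. D \<subseteq> B" if "D \<in> kblocks k w" for D
    using that w by (auto simp: kblocks_def refines_def)
  then obtain F where F: "packing F" "kblocks k w \<subseteq> F" "\<forall>D\<in>F. \<exists>B\<in>x. D \<subseteq> B" "card F = a"
    using packing_extend[OF x packing_kblocks[OF wp] _ a[unfolded nb_def]] unfolding nb_def by blast
  obtain y where y: "partition_on A y" "kt y" "kblocks k y = F" using packing_partition[OF F(1)] .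
  show ?thesis
  proof
    show "le w y" using refines_ktype_iff[OF wp w(1) y(1,2)] y F by simp
    show "le y x" by (rule refines_ktypeI[OF y(1,2) x]) (use F y in blast)
  qed (use y F in \<open>auto simp: nb_def\<close>)
qed

lemma bottom_kt: "kt (bottom_partition n)" "nb (bottom_partition n) = 0"
proof -
  show "kt (bottom_partition n)" by (auto simp: ktype_def bottom_partition_def)
  have "kblocks k (bottom_partition n) = {}" using k2 by (auto simp: kblocks_def bottom_partition_def)
  then show "nb (bottom_partition n) = 0" by (simp add: nb_def)
qed

lemma bottom_le: "partition_on A x \<Longrightarrow> le (bottom_partition n) x"
  unfolding refines_def using part_bottom partition_onD1[of A x] by (auto simp: bottom_partition_def)

text \<open>Condition \<open>C\<^sub>k\<close> enters only here.\<close>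

lemma gamma_split:
  assumes "partition_type x \<in> \<Lambda>" "\<not> kt x" "le x \<pi>"
  obtains z where "z \<in> I" "kt z" "le z x" "z \<noteq> x" "nb z = max_kblocks k x"
proof -
  have x: "partition_on A x" using assms by (auto dest: le_part)
  \<comment> \<open>Starting from the bottom partition, k-blocks are added until no more fit; the
    resulting type is \<open>gamma k\<close> of the type of \<open>x\<close>.\<close>
  obtain z where z: "kt z" "le z x" "nb z = max_kblocks k x"
    using extend_kt[OF bottom_kt(1) bottom_le[OF x], of "max_kblocks k x"] bottom_kt(2) by auto
  have "partition_type z = gamma k (partition_type x)"
    using kt_type[OF le_part(1)[OF z(2)] z(1)] gamma_eq[OF x] z(3) by simp
  then have "partition_type z \<in> \<Lambda>" using cond_C assms(1) by (simp add: condition_C_def)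
  moreover have "z \<noteq> x" using z assms by auto
  moreover have "le z \<pi>" using refines_trans z(2) assms(3) by blast
  moreover have "z \<noteq> \<pi>" using refines_asym z(2) assms(3) \<open>z \<noteq> x\<close> by blast
  ultimately show ?thesis using that z by (simp add: I_iff)
qed

text \<open>For \<open>x = \<pi>\<close> the type need not lie in \<open>\<Lambda>\<close>, or
  \<open>\<pi>\<close> may itself be of k-type. There the argument starts from an arbitrary element
  of the nonempty interval and passes below it if necessary.\<close>

lemma kt_below_exists:
  assumes "x = \<pi> \<or> x \<in> I \<and> \<not> kt x"
  shows "\<exists>z\<in>I. kt z \<and> le z x \<and> z \<noteq> x"
proof -
  have *: "\<exists>z\<in>I. kt z \<and> le z x \<and> z \<noteq> x" if "x \<in> I" "\<not> kt x" for x
  proof -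
    have "partition_type x \<in> \<Lambda>" "le x \<pi>" using that by (auto simp: I_iff)
    from gamma_split[OF this(1) that(2) this(2)] show ?thesis by blast
  qed
  show ?thesis
  proof (cases "x = \<pi>")
    case True
    obtain \<tau> where \<tau>: "\<tau> \<in> I" using I_nonempty by blast
    show ?thesis
    proof (cases "kt \<tau>")
      case True
      then show ?thesis using \<tau> \<open>x = \<pi>\<close> by (auto simp: I_iff)
    next
      case False
      then obtain z where "z \<in> I" "kt z" using * \<tau> by blast
      then show ?thesis using \<open>x = \<pi>\<close> by (auto simp: I_iff)
    qed
  qed (use * assms in blast)
qed

text \<open>An element \<open>z\<close> with the maximal number of k-blocks need not lie above
  \<open>w\<close>. However, extending \<open>w\<close> to the same number of k-blocks gives the
  type of \<open>z\<close>, which is in \<open>\<Lambda>\<close>. The alternative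
  \<open>nb w = 0\<close> admits the bottom partition, which is not in the interval.\<close>

lemma full_exists:
  assumes x: "x = \<pi> \<or> x \<in> I \<and> \<not> kt x"
    and w: "kt w" "le w x" "nb w = 0 \<or> w \<in> I \<and> w \<noteq> x"
  obtains y where "full y x" "le w y"
proof -
  have x_\<pi>: "le x \<pi>" using x le_\<pi> refines_refl part_\<pi> by blast
  define S where "S = {z \<in> I. kt z \<and> le z x \<and> z \<noteq> x}"
  have S: "finite S" "S \<noteq> {}" using kt_below_exists[OF x] finite_P unfolding S_def by auto
  then obtain z where z: "z \<in> S" "\<And>v. v \<in> S \<Longrightarrow> nb v \<le> nb z"
    using Max_in[of "nb ` S"] Max_ge[of "nb ` S"] by fastforce
  then have z': "z \<in> I" "kt z" "le z x" "z \<noteq> x" by (auto simp: S_def)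
  have "nb w \<le> nb z" using w z(2)[of w] by (auto simp: S_def)
  then obtain y where y: "kt y" "le w y" "le y x" "nb y = nb z"
    using extend_kt[OF w(1,2) _ nb_le_max[OF z'(3)]] by blast
  have y_part: "partition_on A y" using y by (auto dest: le_part)
  have "partition_type y = partition_type z"
    using kt_type[OF y_part y(1)] kt_type[OF I_part[OF z'(1)] z'(2)] y(4) by simp
  \<comment> \<open>If \<open>y\<close> were \<open>x\<close>, then \<open>z\<close> would be a
    k-type element below it with equally many k-blocks, hence equal to \<open>x\<close>.\<close>
  moreover have "y \<noteq> x"
    using kt_le_eq[OF I_part[OF z'(1)] z'(2) y_part y(1)] z' y(4) by auto
  moreover have "y \<noteq> \<pi>" using refines_asym[of A x \<pi>] x_\<pi> y(3) \<open>y \<noteq> x\<close> by auto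
  moreover have "le y \<pi>" using refines_trans y(3) x_\<pi> by blast
  ultimately have "y \<in> I" using z'(1) by (simp add: I_iff)
  then have "full y x" using y \<open>y \<noteq> x\<close> z(2) unfolding full_def S_def by auto
  then show ?thesis using that y by blast
qed

text \<open>Full elements are of k-type and so never serve as a pivot inside the chain.\<close>

lemma pv_drop_full:
  assumes "c \<in> \<Delta>" shows "pv (drop_full c) = pv c"
proof (rule pv_eqI)
  show "drop_full c \<in> \<Delta>" using \<Delta>_subset[OF assms] by (auto simp: drop_full_def)
  show "pivot (drop_full c) (pv c)"
    using pivot_pv[OF assms] unfolding pivot_def drop_full_def fulls_def full_def by blast
qed

lemma fulls_drop_full: "c \<in> \<Delta> \<Longrightarrow> fulls (drop_full c) = {}"
  using pv_drop_full unfolding fulls_def drop_full_def by auto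

lemma upper_drop_full:
  assumes "c \<in> \<Delta>" shows "upper (drop_full c) = upper c"
proof -
  have "\<not> le (pv c) z" if "z \<in> fulls c" for z
    using that refines_asym[of A z "pv c"] unfolding fulls_def full_def by blast
  then show ?thesis unfolding upper_def pv_drop_full[OF assms] by (auto simp: drop_full_def)
qed

lemma key_drop_full:
  assumes "c \<in> \<Delta>" shows "key (drop_full c) = key c"
proof -
  have "drop_full (drop_full c) = drop_full c"
    using fulls_drop_full[OF assms] by (subst drop_full_def) simp
  then show ?thesis using upper_drop_full[OF assms] by (simp add: key_def)
qed

section \<open>The key increases along cofaces\<close>

lemma key_less_if_upper:
  assumes "\<sigma> \<in> \<Delta>" "\<rho> \<in> \<Delta>" "upper \<sigma> \<subset> upper \<rho>"
  shows "key \<sigma> < key \<rho>"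
proof -
  have "finite (upper \<rho>)" using \<Delta>D(1)[OF assms(2)] by (simp add: upper_def)
  then have "Suc (card (upper \<sigma>)) \<le> card (upper \<rho>)" using assms(3) by (simp add: psubset_card_mono Suc_leI)
  then have "Suc (card I) * Suc (card (upper \<sigma>)) \<le> Suc (card I) * card (upper \<rho>)" by (rule mult_le_mono2)
  moreover have "card (drop_full \<sigma>) \<le> card I"
    using \<Delta>D(2)[OF assms(1)] finite_P by (intro card_mono) (auto simp: drop_full_def)
  ultimately show ?thesis unfolding key_def by simp
qed

text \<open>Enlarging a chain can only lower its pivot, so \<open>upper\<close> grows. If it does
  not grow strictly, the pivot stays the same, and \<open>\<rho>\<close> either has additional
  non-full members or differs from \<open>\<sigma>\<close> at most by the full element.\<close>

lemma key_less_coface: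
  assumes \<sigma>: "\<sigma> \<in> \<Delta> - toggled" and \<rho>: "\<rho> \<in> \<Delta>" and sub: "\<sigma> \<subseteq> \<rho>"
  shows "\<rho> = \<sigma> \<or> \<rho> \<in> toggled \<and> drop_full \<rho> = \<sigma> \<or> key \<sigma> < key \<rho>"
proof -
  have \<sigma>\<Delta>: "\<sigma> \<in> \<Delta>" and no_full: "fulls \<sigma> = {}" using \<sigma> by (auto simp: toggled_def)
  have le_pv: "le (pv \<rho>) (pv \<sigma>)" using \<sigma>\<Delta>
  proof (cases rule: pv_cases)
    case 1
    then show ?thesis using pivot_pv[OF \<rho>] sub unfolding pivot_def by blast
  next
    case 2
    then show ?thesis using pv_le_\<pi>[OF \<rho>] by simp
  qed
  have upper_sub: "upper \<sigma> \<subseteq> upper \<rho>"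
    using sub le_pv refines_trans unfolding upper_def by blast
  show ?thesis
  proof (cases "upper \<sigma> = upper \<rho>")
    case False
    then show ?thesis using key_less_if_upper[OF \<sigma>\<Delta> \<rho>] upper_sub by blast
  next
    case True
    \<comment> \<open>A pivot inside \<open>\<rho>\<close> belongs to \<open>upper \<rho>\<close>,
      hence to \<open>upper \<sigma>\<close>, and is not strictly below \<open>pv \<sigma>\<close>.
      If it is \<open>\<pi>\<close> because \<open>\<rho>\<close> consists of k-type elements, so
      does \<open>\<sigma>\<close>.\<close>
    have pv_eq: "pv \<rho> = pv \<sigma>" using \<rho>
    proof (cases rule: pv_cases)
      case 1
      then have "pv \<rho> \<in> upper \<rho>" using refines_refl[OF I_part] by (simp add: upper_def)
      then have "le (pv \<sigma>) (pv \<rho>)" using True by (auto simp: upper_def)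
      then show ?thesis using refines_asym le_pv by blast
    next
      case 2
      then have "pivot \<sigma> \<pi>" using sub unfolding pivot_def by blast
      then show ?thesis using pv_eqI[OF \<sigma>\<Delta>] 2 by simp
    qed
    have "\<sigma> \<subseteq> drop_full \<rho>"
      using sub no_full pv_eq unfolding drop_full_def fulls_def by auto
    show ?thesis
    proof (cases "\<sigma> = drop_full \<rho>")
      case True
      then show ?thesis using \<rho> by (auto simp: toggled_def drop_full_def)
    next
      case False
      have "finite (drop_full \<rho>)" using \<Delta>D(1)[OF \<rho>] by (simp add: drop_full_def)
      then have "card \<sigma> < card (drop_full \<rho>)"
        using False \<open>\<sigma> \<subseteq> drop_full \<rho>\<close> by (simp add: psubset_card_mono psubsetI)
      moreover have "drop_full \<sigma> = \<sigma>" using no_full by (simp add: drop_full_def)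
      ultimately show ?thesis using \<open>upper \<sigma> = upper \<rho>\<close> by (simp add: key_def)
    qed
  qed
qed

text \<open>A full element above the part of the chain below the pivot is comparable with every
  member. Being of k-type, it leaves the pivot unchanged.\<close>

lemma insert_full:
  assumes \<sigma>: "\<sigma> \<in> \<Delta> - toggled"
  shows "\<exists>\<tau>\<in>toggled. drop_full \<tau> = \<sigma>"
proof -
  have \<sigma>\<Delta>: "\<sigma> \<in> \<Delta>" and no_full: "fulls \<sigma> = {}" using \<sigma> by (auto simp: toggled_def)
  define x where "x = pv \<sigma>"
  have x: "x = \<pi> \<or> x \<in> I \<and> \<not> kt x" using pv_cases[OF \<sigma>\<Delta>] unfolding x_def by metis
  have x_part: "partition_on A x" using pv_le_\<pi>[OF \<sigma>\<Delta>] by (auto simp: x_def dest: le_part)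
  define K where "K = {z \<in> \<sigma>. \<not> le x z}"
  have K: "kt z" "le z x" "z \<noteq> x" "z \<in> I" if "z \<in> K" for z
    using below_pv[OF \<sigma>\<Delta>, of z] \<Delta>_I[OF \<sigma>\<Delta>] that unfolding K_def x_def by auto
  \<comment> \<open>The largest member below the pivot. If there is none, the bottom partition takes
    its place.\<close>
  obtain w where w: "kt w" "le w x" "nb w = 0 \<or> w \<in> I \<and> w \<noteq> x" "\<And>z. z \<in> K \<Longrightarrow> le z w"
  proof (cases "K = {}")
    case True
    then show ?thesis using that[of "bottom_partition n"] bottom_kt bottom_le[OF x_part] by simp
  next
    case False
    then obtain w where "w \<in> K" "\<forall>z\<in>K. le z w"
      using chain_greatest[OF \<sigma>\<Delta>, of K] unfolding K_def by auto
    then show ?thesis using that[of w] K[of w] by blast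
  qed
  obtain y where y: "full y x" "le w y" using full_exists[OF x w(1-3)] .
  have y_I: "y \<in> I" "kt y" "le y x" using y by (auto simp: full_def)
  let ?\<tau> = "insert y \<sigma>"
  have comp: "le z y \<or> le y z" if "z \<in> \<sigma>" for z
  proof (cases "z \<in> K")
    case True
    then show ?thesis using w(4) y(2) refines_trans by blast
  next
    case False
    then show ?thesis using that y_I(3) refines_trans unfolding K_def by blast
  qed
  have \<tau>\<Delta>: "?\<tau> \<in> \<Delta>"
    using \<sigma>\<Delta> y_I(1) comp refines_refl[OF I_part[OF y_I(1)]] unfolding order_complex_def by auto
  have "pivot ?\<tau> x"
    using pivot_pv[OF \<sigma>\<Delta>] y_I(2) unfolding pivot_def x_def by auto
  then have pv_\<tau>: "pv ?\<tau> = x" by (rule pv_eqI[OF \<tau>\<Delta>])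
  have "y \<in> fulls ?\<tau>" using y(1) pv_\<tau> by (simp add: fulls_def)
  moreover have "fulls ?\<tau> \<inter> \<sigma> = {}" using no_full pv_\<tau> by (auto simp: fulls_def x_def)
  ultimately have "?\<tau> \<in> toggled" "drop_full ?\<tau> = \<sigma>"
    using \<tau>\<Delta> by (auto simp: toggled_def drop_full_def fulls_def)
  then show ?thesis by blast
qed

lemma toggled_decomp:
  assumes "\<tau> \<in> toggled"
  obtains y where "full y (pv \<tau>)" "\<tau> = insert y (drop_full \<tau>)" "y \<notin> drop_full \<tau>" "y \<in> \<tau>"
proof -
  have \<tau>: "\<tau> \<in> \<Delta>" using assms by (simp add: toggled_def)
  obtain y where y: "y \<in> \<tau>" "full y (pv \<tau>)" using assms by (auto simp: toggled_def fulls_def)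
  then have "fulls \<tau> = {y}" using full_unique[OF \<tau>] unfolding fulls_def by blast
  then show ?thesis using that y unfolding drop_full_def by blast
qed

text \<open>The permutation has to fix \<open>W\<close>, everything weakly above \<open>x\<close>,
  and \<open>\<pi>\<close>. The first two cases preserve every block of \<open>x\<close>; the third
  permutes the blocks of \<open>x = \<pi>\<close>.\<close>

lemma full_conjugate:
  assumes x: "x = \<pi> \<or> x \<in> I \<and> \<not> kt x" and y: "full y x" "full y' x"
    and W: "W \<subseteq> kblocks k y" "W \<subseteq> kblocks k y'"
  shows "\<exists>g. g permutes A \<and> act g y = y' \<and> (\<forall>D\<in>W. g ` D = D) \<and> act g \<pi> = \<pi> \<and>
    (\<forall>z\<in>I. le x z \<longrightarrow> act g z = z)"
proof -
  have x_\<pi>: "le x \<pi>" using x le_\<pi> refines_refl part_\<pi> by blast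
  have x_part: "partition_on A x" using x_\<pi> by (auto dest: le_part)
  have fy: "partition_on A v" "kt v" "le v x" if "full v x" for v
    using that I_part unfolding full_def by auto
  have nb_eq: "nb y = nb y'" using y unfolding full_def by (meson le_antisym)
  have blockwise: ?thesis
    if count: "\<And>B. B \<in> x \<Longrightarrow> card {D \<in> kblocks k y. D \<subseteq> B} = card {D \<in> kblocks k y'. D \<subseteq> B}"
  proof -
    obtain g where g: "g permutes A" "\<And>B. B \<in> x \<Longrightarrow> g ` B = B" "act g y = y'" "\<forall>D\<in>W. g ` D = D"
      using ktype_conjugate_blockwise[OF x_part fy[OF y(1)] fy[OF y(2)] W count] by auto
    have "act g z = z" if "le x z" for z
      by (rule permute_fixes_coarser[OF g(1) that g(2) finite_A])
    then show ?thesis using g x_\<pi> by blast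
  qed
  consider "partition_type x \<in> \<Lambda>" "\<not> kt x" | "x = \<pi>" "partition_type \<pi> = {#n#}" | "x = \<pi>" "kt \<pi>"
    using x type_\<pi> by (auto simp: I_iff)
  then show ?thesis
  proof cases
    case 1
    \<comment> \<open>\<open>gamma_split\<close> supplies a competitor with the largest conceivable
      number of k-blocks, so every full element attains it. The number in each single block is then
      forced.\<close>
    have "nb v = max_kblocks k x" if v: "full v x" for v
      using gamma_split[OF 1 x_\<pi>] v nb_le_max[OF fy(3)[OF v]] unfolding full_def by (metis le_antisym)
    then have "card {D \<in> kblocks k v. D \<subseteq> B} = card B div k" if v: "full v x" and B: "B \<in> x" for v B
      using card_packing_eq_max[OF x_part packing_kblocks[OF fy(1)[OF v]] _ _ B] v fy(3)[OF v]
      unfolding nb_def by (auto simp: kblocks_def refines_def)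
    then show ?thesis using blockwise y by simp
  next
    case 2
    have "size (partition_type \<pi>) = card \<pi>" by (simp add: partition_type_def)
    then have "card x = 1" using 2 by simp
    then obtain B where "x = {B}" by (rule card_1_singletonE)
    then have x_A: "x = {A}" using partition_onD1[OF x_part] by simp
    \<comment> \<open>With a single block the blockwise count is the total \<open>nb\<close>, which
      agrees for any two full elements.\<close>
    have "{D \<in> kblocks k v. D \<subseteq> A} = kblocks k v" if "full v x" for v
      using partition_onD1[OF fy(1)[OF that]] by (auto simp: kblocks_def)
    then show ?thesis using blockwise y nb_eq by (simp add: x_A nb_def)
  next
    case 3
    have sub: "kblocks k v \<subseteq> kblocks k x" if "full v x" for v
      using refines_ktype_iff[OF fy(1,2)[OF that] x_part] fy(3)[OF that] 3 by simp
    obtain g where g: "g permutes A" "act g x = x" "act g y = y'" "\<forall>D\<in>W. g ` D = D"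
      using ktype_conjugate_in_ktype[OF x_part _ fy(1,2)[OF y(1)] sub[OF y(1)] fy(1,2)[OF y(2)] sub[OF y(2)] W]
        3 nb_eq unfolding nb_def by auto
    \<comment> \<open>Nothing in the interval lies above \<open>\<pi>\<close>, so permuting the
      blocks of \<open>\<pi>\<close> violates no condition.\<close>
    moreover have "\<not> le x z" if "z \<in> I" for z
      using that 3 le_\<pi> refines_asym[of A z \<pi>] \<pi>_notin_I by blast
    ultimately show ?thesis using 3 by blast
  qed
qed

text \<open>Two full extensions of one chain have the same pivot. A permutation carrying one full
  element to the other while fixing the common chain therefore identifies the two
  extensions.\<close>

lemma drop_full_conjugate:
  assumes "\<tau> \<in> toggled" "\<tau>' \<in> toggled" and eq: "drop_full \<tau> = drop_full \<tau>'"
  shows "orb \<tau> = orb \<tau>'"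
proof -
  have \<Delta>: "\<tau> \<in> \<Delta>" "\<tau>' \<in> \<Delta>" using assms by (auto simp: toggled_def)
  define x \<sigma> where "x = pv \<tau>" and "\<sigma> = drop_full \<tau>"
  have pv': "pv \<tau>' = x" using pv_drop_full \<Delta> eq unfolding x_def by metis
  have x: "x = \<pi> \<or> x \<in> I \<and> \<not> kt x" using pv_cases[OF \<Delta>(1)] unfolding x_def by metis
  obtain y where y: "full y x" "\<tau> = insert y \<sigma>" "y \<in> \<tau>"
    unfolding x_def \<sigma>_def by (rule toggled_decomp[OF assms(1)])
  obtain y' where y': "full y' x" "\<tau>' = insert y' \<sigma>" "y' \<in> \<tau>'"
    unfolding pv'[symmetric] \<sigma>_def eq by (rule toggled_decomp[OF assms(2)])
  define K where "K = {z \<in> \<sigma>. \<not> le x z}"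
  have K: "kt z" "le z x" "z \<noteq> x" "z \<in> I" "z \<in> \<tau>" "z \<in> \<tau>'" if "z \<in> K" for z
    using below_pv[OF \<Delta>(1), of z] \<Delta>_I[OF \<Delta>(1)] that y(2) y'(2) unfolding K_def x_def by auto
  \<comment> \<open>Fixing these k-blocks setwise suffices to fix every member of the chain below
    the pivot. By \<open>kt_below_full\<close> they are k-blocks of both \<open>y\<close> and
    \<open>y'\<close>.\<close>
  define W where "W = (\<Union>z\<in>K. kblocks k z)"
  have sub: "kblocks k z \<subseteq> kblocks k v" if "z \<in> K" "full v x" "v \<in> c" "c \<in> \<Delta>" "z \<in> c" for z v c
  proof -
    have "le z v" using kt_below_full[OF that(4,3,5,2)] K[OF that(1)] by blast
    moreover have "kt v" "v \<in> I" using that(2) by (auto simp: full_def)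
    ultimately show ?thesis using refines_ktype_iff I_part K[OF that(1)] by blast
  qed
  have "W \<subseteq> kblocks k y"
    unfolding W_def by (rule UN_least) (rule sub[OF _ y(1,3) \<Delta>(1) K(5)])
  moreover have "W \<subseteq> kblocks k y'"
    unfolding W_def by (rule UN_least) (rule sub[OF _ y'(1,3) \<Delta>(2) K(6)])
  ultimately obtain g where g: "g permutes A" "act g y = y'" "\<forall>D\<in>W. g ` D = D" "act g \<pi> = \<pi>"
    and g_up: "\<And>z. z \<in> I \<Longrightarrow> le x z \<Longrightarrow> act g z = z"
    using full_conjugate[OF x y(1) y'(1), of W] by metis
  have "act g z = z" if z: "z \<in> \<sigma>" for z
  proof (cases "z \<in> K")
    case True
    then show ?thesis
      using permute_fixes_ktype[OF I_part[OF K(4)[OF True]] g(1) K(1)[OF True]] g(3) unfolding W_def by blast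
  next
    case False
    then show ?thesis using g_up \<Delta>_I[OF \<Delta>(1)] z y(2) unfolding K_def by blast
  qed
  then have "act g ` \<tau> = \<tau>'" using y(2) y'(2) g(2) by simp
  moreover have "g \<in> carrier (Stab n \<pi>)" using g by (simp add: carrier_Stab)
  ultimately show ?thesis using orb_eqI by metis
qed

section \<open>Equivariance under the stabilizer\<close>

context
  fixes g assumes g: "g \<in> carrier (Stab n \<pi>)"
begin

lemma g_permutes: "g permutes A" "act g \<pi> = \<pi>"
  using g by (auto simp: carrier_Stab)

text \<open>\<open>act_leq_iff\<close> covers only the interval, whereas a pivot may be
  \<open>\<pi>\<close>, which lies outside it.\<close>

lemma act_le_iff: "le (act g a) (act g b) \<longleftrightarrow> le a b"
proof
  assume "le (act g a) (act g b)"
  moreover have "inv\<^bsub>Stab n \<pi>\<^esub> g permutes A" using inv_closed[OF g] by (simp add: carrier_Stab)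
  ultimately show "le a b" using refines_permute act_inv_act(1)[OF g] by metis
qed (rule refines_permute[OF g_permutes(1)])

lemma act_eq_iff: "act g a = act g b \<longleftrightarrow> a = b"
  using injD[OF act_inj[OF g]] by blast

lemma nb_act: "nb (act g a) = nb a"
  unfolding nb_def kblocks_permute[OF g_permutes(1)] by (rule card_permute[OF g_permutes(1)])

lemma full_act: "full (act g y) (act g x) \<longleftrightarrow> full y x"
proof -
  \<comment> \<open>The competitors \<open>z\<close> are reindexed along \<open>act g\<close>, which
    maps the interval bijectively onto itself.\<close>
  have "(\<forall>z\<in>I. kt z \<and> le z (act g x) \<and> z \<noteq> act g x \<longrightarrow> nb z \<le> nb y)
    \<longleftrightarrow> (\<forall>z\<in>I. kt (act g z) \<and> le (act g z) (act g x) \<and> act g z \<noteq> act g x \<longrightarrow> nb (act g z) \<le> nb y)"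
    using act_P[OF g] act_P[OF inv_closed[OF g]] act_inv_act(2)[OF g] by metis
  then show ?thesis
    unfolding full_def by (simp add: act_P_iff[OF g] ktype_permute[OF g_permutes(1)] act_le_iff act_eq_iff nb_act)
qed

lemma pivot_act: "pivot c x \<Longrightarrow> pivot (act g ` c) (act g x)"
  unfolding pivot_def by (auto simp: ktype_permute[OF g_permutes(1)] act_le_iff g_permutes(2))

lemma pv_act: "c \<in> \<Delta> \<Longrightarrow> pv (act g ` c) = act g (pv c)"
  using pv_eqI[OF act_\<Delta>[OF g]] pivot_act pivot_pv by blast

lemma fulls_act: "c \<in> \<Delta> \<Longrightarrow> fulls (act g ` c) = act g ` fulls c"
  unfolding fulls_def pv_act by (auto simp: full_act)

lemma drop_full_act: "c \<in> \<Delta> \<Longrightarrow> drop_full (act g ` c) = act g ` drop_full c"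
  unfolding drop_full_def fulls_act by (rule image_set_diff[OF act_inj[OF g], symmetric])

lemma upper_act: "c \<in> \<Delta> \<Longrightarrow> upper (act g ` c) = act g ` upper c"
  unfolding upper_def pv_act by (auto simp: act_le_iff)

lemma key_act: "c \<in> \<Delta> \<Longrightarrow> key (act g ` c) = key c"
  unfolding key_def by (simp add: upper_act drop_full_act card_image_act[OF g])

lemma toggled_act: "c \<in> toggled \<Longrightarrow> act g ` c \<in> toggled"
  unfolding toggled_def by (simp add: fulls_act act_\<Delta>[OF g])

end

lemma collapsible_interval: "collapsible cells quotient_face"
proof (rule collapsible_quotient[where T = toggled and rem = drop_full and key = key])
  have \<Delta>: "\<tau> \<in> \<Delta>" if "\<tau> \<in> toggled" for \<tau> using that by (simp add: toggled_def)
  show "toggled \<subseteq> \<Delta>" using \<Delta> by blast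
  show "drop_full (act g ` \<tau>) = act g ` drop_full \<tau>" if "g \<in> carrier (Stab n \<pi>)" "\<tau> \<in> toggled" for g \<tau>
    using that drop_full_act \<Delta> by blast
  show "drop_full \<tau> \<notin> toggled" "key (drop_full \<tau>) = key \<tau>" if "\<tau> \<in> toggled" for \<tau>
    using fulls_drop_full[OF \<Delta>[OF that]] key_drop_full[OF \<Delta>[OF that]] by (auto simp: toggled_def)
  show "drop_full \<tau> \<subset> \<tau>" if "\<tau> \<in> toggled" for \<tau>
    by (rule toggled_decomp[OF that]) auto
  show "card \<tau> = 1" if \<tau>: "\<tau> \<in> toggled" "drop_full \<tau> = {}" for \<tau>
    by (rule toggled_decomp[OF \<tau>(1)]) (use \<tau>(2) in simp)
  show "orb \<tau> = orb \<tau>'" if "\<tau> \<in> toggled" "\<tau>' \<in> toggled" "drop_full \<tau> = drop_full \<tau>'" for \<tau> \<tau>'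
    using that by (rule drop_full_conjugate)
  show "\<rho> = \<sigma> \<or> \<rho> \<in> toggled \<and> drop_full \<rho> = \<sigma> \<or> key \<sigma> < key \<rho>"
    if "\<sigma> \<in> \<Delta> - toggled" "\<rho> \<in> \<Delta>" "\<sigma> \<subseteq> \<rho>" for \<sigma> \<rho>
    using that by (rule key_less_coface)
qed (simp_all add: toggled_act key_act insert_full)

end

theorem theorem3p4p2:
  fixes n k :: nat and \<Lambda> :: "nat multiset set" and \<mu> :: "nat multiset" and \<pi> :: "nat set set"
  assumes "2 \<le> k" and "k < n"
    and "\<Lambda> \<subseteq> number_partitions n"
    and "replicate_mset n 1 \<notin> \<Lambda>" and "{#n#} \<notin> \<Lambda>"
    and "condition_C k \<Lambda>"
    and "\<mu> \<in> \<Lambda> \<union> {{#n#}}"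
    and "partition_on {1..n} \<pi>" and "partition_type \<pi> = \<mu>"
    and nonempty: "open_interval n \<Lambda> \<pi> \<noteq> {}"
  shows "collapsible (quotient_cells (Stab n \<pi>) permute_partition (interval_complex n \<Lambda> \<pi>)) quotient_face \<and>
    (\<forall>i::int. trivial_multiplicity (Stab n \<pi>)
       (\<lambda>g. homology_map (interval_complex n \<Lambda> \<pi>) (refines {1..n}) i (permute_partition g))
       (reduced_homology (interval_complex n \<Lambda> \<pi>) (refines {1..n}) i) = 0)"
proof -
  interpret partition_interval n k \<Lambda> \<pi>
    using assms by unfold_locales auto
  show ?thesis
    unfolding interval_complex_def
    using collapsible_interval trivial_multiplicity_zero[OF collapsible_interval] by blast
qed

end
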